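(* Let $i, j$ be nonnegative integers, and let $n = 5^i \cdot 7^j$. There exists a cyclically 5-edge-connected snark $G$ with an edge $e$ such that $\psi(G,e) = n$.
   Context: All graphs are undirected. A graph is simple if it is connected, has finitely many vertices, and has no loops or multiple edges; it is cubic if each vertex is attached to exactly 3 edges. A 3-edge-colouring assigns one of three colours to each edge so that no two adjacent edges receive the same colour. A 3-edge-decomposition is a partition of the edges into three (unordered) classes such that no two adjacent edges are in the same class; so each 3-edge-decomposition of a cubic graph corresponds to exactly $3! = 6$ 3-edge-colourings. For a positive integer $m$, two disjoint (no common vertices) connected subgraphs $A,B$ of a simple graph $G$ are $m$-edge-connected to each other in $G$ if there exist $m$ mutually edge-disjoint paths in $G$, each having one endpoint in $A$ and the other in $B$ (equivalently, there is no set $S$ of at most $m-1$ edges of $G$ such that $A$ and $B$ lie in different components of $G-S$). A simple graph $G$ is cyclically $m$-edge-connected if every two vertex-disjoint cycles of $G$ are $m$-edge-connected to each other in $G$. A snark is a simple cubic graph that is not 3-edge-colourable, has girth at least 5, and is (at least) cyclically 4-edge-connected. Edge subtraction: given an edge $e=(u,v)$ of a cubic graph $G$, remove $e$; this leaves divalent vertices $u$ and $v$, with edges $(u,u_1),(u,u_2),(v,v_1),(v,v_2)$. Delete $u$ and $v$ and these edges, and form new edges $(u_1,u_2)$ and $(v_1,v_2)$. The resulting cubic graph is $G_e$. The number $\psi(G,e)$: for $G$ a simple, non-3-edge-colourable cubic graph and $e$ an edge of $G$, it is known that the number of 3-edge-decompositions of $G_e$ equals $3J$ for some nonnegative integer $J$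 (possibly $0$); define $\psi(G,e) := J$. Equivalently, the number of 3-edge-colourings of $G_e$ (with a fixed set of three colours) is $18\,\psi(G,e)$. *)

theory Defs
  imports
    "HOL-Library.Disjoint_Sets"
    "HOL-Library.Extended_Nat"
    "HOL-Library.FuncSet"
begin

type_synonym 'v ugraph = "'v set \<times> 'v set set"

abbreviation uverts :: "'v ugraph \<Rightarrow> 'v set" where "uverts G \<equiv> fst G"
abbreviation uedges :: "'v ugraph \<Rightarrow> 'v set set" where "uedges G \<equiv> snd G"

definition graph_path :: "'v ugraph \<Rightarrow> 'v list \<Rightarrow> bool" where
  "graph_path G p \<longleftrightarrow>
     p \<noteq> [] \<and> set p \<subseteq> uverts G \<and> distinct p \<and> successively (\<lambda>x y. {x, y} \<in> uedges G) p"

definition path_edges :: "'v list \<Rightarrow> 'v set set" where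
  "path_edges p = {{p ! i, p ! Suc i} | i. Suc i < length p}"

definition connected_graph :: "'v ugraph \<Rightarrow> bool" where
  "connected_graph G \<longleftrightarrow>
     uverts G \<noteq> {} \<and>
     (\<forall>x\<in>uverts G. \<forall>y\<in>uverts G. \<exists>p. graph_path G p \<and> hd p = x \<and> last p = y)"

definition simple_graph :: "'v ugraph \<Rightarrow> bool" where
  "simple_graph G \<longleftrightarrow>
     finite (uverts G) \<and> (\<forall>e\<in>uedges G. e \<subseteq> uverts G \<and> card e = 2) \<and> connected_graph G"

definition cubic_graph :: "'v ugraph \<Rightarrow> bool" where
  "cubic_graph G \<longleftrightarrow> (\<forall>v\<in>uverts G. card {e \<in> uedges G. v \<in> e} = 3)"

definition graph_cycle :: "'v ugraph \<Rightarrow> 'v list \<Rightarrow> bool" where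
  "graph_cycle G c \<longleftrightarrow> graph_path G c \<and> 3 \<le> length c \<and> {last c, hd c} \<in> uedges G"

definition graph_girth :: "'v ugraph \<Rightarrow> enat" where
  "graph_girth G = (INF c\<in>{c. graph_cycle G c}. enat (length c))"

text \<open>
  The notion only depends on the vertex sets \<open>A\<close> and \<open>B\<close> of the two
  disjoint connected subgraphs, so these are taken as arguments. For disjoint \<open>A\<close> and
  \<open>B\<close> every path below has at least one edge, so edge-disjoint paths are distinct.
\<close>
definition edge_connected_to :: "nat \<Rightarrow> 'v ugraph \<Rightarrow> 'v set \<Rightarrow> 'v set \<Rightarrow> bool" where
  "edge_connected_to m G A B \<longleftrightarrow>
     (\<exists>p. (\<forall>k<m. graph_path G (p k) \<and> hd (p k) \<in> A \<and> last (p k) \<in> B) \<and>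
          (\<forall>k<m. \<forall>l<m. k \<noteq> l \<longrightarrow> path_edges (p k) \<inter> path_edges (p l) = {}))"

definition cyclically_edge_connected :: "nat \<Rightarrow> 'v ugraph \<Rightarrow> bool" where
  "cyclically_edge_connected m G \<longleftrightarrow>
     (\<forall>c d. graph_cycle G c \<and> graph_cycle G d \<and> set c \<inter> set d = {} \<longrightarrow>
            edge_connected_to m G (set c) (set d))"

text \<open>
  Subtracting an edge from a simple cubic graph may create parallel edges (but never loops),
  so edge colourings are defined for loopless multigraphs with named edges.
\<close>
record ('v, 'e) multigraph =
  mverts :: "'v set"
  medges :: "'e set"
  mends :: "'e \<Rightarrow> 'v set"

definition multigraph_of :: "'v ugraph \<Rightarrow> ('v, 'v set) multigraph" where
  "multigraph_of G = \<lparr>mverts = uverts G, medges = uedges G, mends = (\<lambda>e. e)\<rparr>"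

definition adjacent_edges :: "('v, 'e) multigraph \<Rightarrow> 'e \<Rightarrow> 'e \<Rightarrow> bool" where
  "adjacent_edges M e f \<longleftrightarrow> e \<noteq> f \<and> mends M e \<inter> mends M f \<noteq> {}"

definition three_edge_colourings :: "('v, 'e) multigraph \<Rightarrow> ('e \<Rightarrow> nat) set" where
  "three_edge_colourings M =
     {c \<in> medges M \<rightarrow>\<^sub>E {..<3}.
        \<forall>e\<in>medges M. \<forall>f\<in>medges M. adjacent_edges M e f \<longrightarrow> c e \<noteq> c f}"

definition three_edge_colourable :: "'v ugraph \<Rightarrow> bool" where
  "three_edge_colourable G \<longleftrightarrow> three_edge_colourings (multigraph_of G) \<noteq> {}"

text \<open>
  Requiring the three classes to be nonempty, as \<open>partition_on\<close> does, is no restriction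
  for cubic multigraphs with at least one vertex.
\<close>
definition three_edge_decompositions :: "('v, 'e) multigraph \<Rightarrow> 'e set set set" where
  "three_edge_decompositions M =
     {P. partition_on (medges M) P \<and> card P = 3 \<and>
         (\<forall>C\<in>P. \<forall>e\<in>C. \<forall>f\<in>C. \<not> adjacent_edges M e f)}"

definition snark :: "'v ugraph \<Rightarrow> bool" where
  "snark G \<longleftrightarrow>
     simple_graph G \<and> cubic_graph G \<and> \<not> three_edge_colourable G \<and>
     5 \<le> graph_girth G \<and> cyclically_edge_connected 4 G"

text \<open>
  The graph \<open>G\<^sub>e\<close> for an edge \<open>e = {u, v}\<close> of a simple cubic graph \<open>G\<close>. The edges of
  \<open>G\<close> avoiding \<open>u\<close> and \<open>v\<close> survive as \<open>Inl f\<close>. For each end \<open>x\<close> of \<open>e\<close>, the new edge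
  \<open>Inr x\<close> joins the two neighbours of \<open>x\<close> other than the opposite end of \<open>e\<close>.
\<close>
definition edge_subtraction :: "'v ugraph \<Rightarrow> 'v set \<Rightarrow> ('v, 'v set + 'v) multigraph" where
  "edge_subtraction G e =
     \<lparr>mverts = uverts G - e,
      medges = Inl ` {f \<in> uedges G. f \<inter> e = {}} \<union> Inr ` e,
      mends = case_sum (\<lambda>f. f) (\<lambda>x. {y. {x, y} \<in> uedges G \<and> {x, y} \<noteq> e})\<rparr>"

definition psi :: "'v ugraph \<Rightarrow> 'v set \<Rightarrow> nat" where
  "psi G e = (THE J. card (three_edge_decompositions (edge_subtraction G e)) = 3 * J)"

end

(*
  A snark is built as a chain of multipoles. A pole has five dangling edges and is closed by a
  pentagon. Call it n-starlike if its numbers of 3-edge-colourings with a given boundary pattern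
  are n times those of a pentagram: n if three dangling edges share a colour and the two others,
  which carry the remaining colours, are not cyclically adjacent, and 0 otherwise. A pentagon
  forces the two singly coloured edges to be adjacent, so the closure of an n-starlike pole is not
  3-edge-colourable, and subtracting an edge of the closing pentagon leaves exactly 3n
  decompositions, that is psi = n. A gadget is a snark with two disjoint pentagons removed. Since
  it sees an n-starlike pole as n copies of one of its pentagons, gluing it on multiplies n by a
  constant; two gadgets found by computer search have the constants 5 and 7.

  All structural requirements on the graph reduce to one condition on cuts: a set of s vertices
  whose complement is not smaller is separated by at least min 5 (s + 2) edges. This survives
  gluing, it implies connectedness and girth at least 5, and together with the edge version of
  Menger's theorem it implies cyclic 5-edge-connectivity.
*)
theory Submission imports Defs begin

section \<open>Menger's theorem for edge-disjoint paths\<close>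

text \<open>The pentagon and the pentagram are complementary 5-cycles on the same five indices, and
  this is used twice. A 5-cycle with a pendant edge at each vertex is coloured by 2 + 2 + 1, so the
  pendant edges show one colour three times and the other two colours at adjacent vertices: a
  pentagram realises exactly the patterns of this shape that a pentagon refuses. Joined index by
  index they form the Petersen graph, which starts the chain with n = 1. For cuts, a pair of indices
  is an edge of only one of the two cycles, so no 4-cycle can arise across a seam. Uniformity keeps
  the count a scalar: all 30 admissible patterns are equally frequent in a starlike pole, so a
  gadget only has to produce each output pattern equally often in total, no matter from which input
  patterns. The cut condition has content from three vertices on. In a simple cubic graph one vertex
  always sends out 3 edges and two vertices at least 4; for three vertices the condition forbids
  triangles, for four it forbids 4-cycles. The small cases stay in it because a small set in the
  glued graph may be split by the seam into two smaller ones.\<close>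

definition edge_boundary :: "'v set set \<Rightarrow> 'v set \<Rightarrow> 'v set set" where
  "edge_boundary E S = {e \<in> E. e \<inter> S \<noteq> {} \<and> \<not> e \<subseteq> S}"

definition arcs :: "'v list \<Rightarrow> ('v \<times> 'v) set" where
  "arcs p = set (zip p (tl p))"

lemma arcs_simps [simp]:
  "arcs [] = {}" "arcs [x] = {}" "arcs (x # y # p) = insert (x, y) (arcs (y # p))"
  by (simp_all add: arcs_def)

lemma arcs_subset: "(x, y) \<in> arcs p \<Longrightarrow> x \<in> set p \<and> y \<in> set p"
  unfolding arcs_def by (metis list.set_sel(2) list.sel(2) set_zip_leftD set_zip_rightD)

lemma successively_arcs: "successively P p \<longleftrightarrow> (\<forall>(x, y)\<in>arcs p. P x y)"
  by (induction p rule: induct_list012) auto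

lemma path_edges_arcs: "path_edges p = (\<lambda>(x, y). {x, y}) ` arcs p"
proof -
  have "path_edges p = {{p ! i, tl p ! i} | i. i < length p \<and> i < length (tl p)}"
    unfolding path_edges_def by (force simp: nth_tl)
  also have "\<dots> = (\<lambda>(x, y). {x, y}) ` arcs p"
    unfolding arcs_def set_zip by auto
  finally show ?thesis .
qed

lemma arcs_asym: "distinct p \<Longrightarrow> (x, y) \<in> arcs p \<Longrightarrow> (y, x) \<notin> arcs p"
proof (induction p rule: induct_list012)
  case (3 a b p)
  then show ?case using arcs_subset[of _ _ "b # p"] by auto
qed auto

lemma rtrancl_distinct_path:
  assumes "(a, b) \<in> {(x, y). P x y}\<^sup>*"
  obtains p where "p \<noteq> []" "hd p = a" "last p = b" "distinct p" "successively P p"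
proof -
  have "\<exists>p. p \<noteq> [] \<and> hd p = a \<and> last p = b \<and> distinct p \<and> successively P p"
    using assms
  proof (induction rule: rtrancl_induct)
    case base
    show ?case by (intro exI[of _ "[a]"]) auto
  next
    case (step y z)
    then obtain p where p: "p \<noteq> []" "hd p = a" "last p = y" "distinct p" "successively P p"
      by blast
    show ?case
    proof (cases "z \<in> set p")
      case False
      with p step show ?thesis
        by (intro exI[of _ "p @ [z]"]) (auto simp: successively_append_iff)
    next
      \<comment> \<open>If \<open>z\<close> was visited before, the old path is cut off at that
        visit instead of being extended.\<close>
      case True
      then obtain q r where "p = q @ z # r" by (auto simp: in_set_conv_decomp)
      with p show ?thesis
        by (intro exI[of _ "q @ [z]"])
          (auto simp: successively_append_iff hd_append split: if_splits)
    qed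
  qed
  with that show ?thesis by blast
qed

lemma rtrancl_graph_path:
  assumes "(a, b) \<in> {(x, y). P x y}\<^sup>*" "a \<in> V"
    and P: "\<And>x y. P x y \<Longrightarrow> {x, y} \<in> E" and E: "\<And>e. e \<in> E \<Longrightarrow> e \<subseteq> V"
  obtains p where "graph_path (V, E) p" "hd p = a" "last p = b" "successively P p"
proof -
  from assms(1) obtain p where
    p: "p \<noteq> []" "hd p = a" "last p = b" "distinct p" "successively P p"
    by (rule rtrancl_distinct_path)
  have "y \<in> V" if "y \<in> set p" for y
  proof -
    have "y = hd p \<or> (\<exists>x. (x, y) \<in> arcs p)"
      using that by (induction p rule: induct_list012) auto
    then show ?thesis
    proof
      assume "\<exists>x. (x, y) \<in> arcs p"
      then obtain x where "P x y" using p(5) by (auto simp: successively_arcs)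
      then show ?thesis using P E[of "{x, y}"] by auto
    qed (use p assms(2) in auto)
  qed
  moreover have "successively (\<lambda>x y. {x, y} \<in> E) p"
    using p(5) P by (auto simp: successively_arcs)
  ultimately have "graph_path (V, E) p" using p by (auto simp: graph_path_def)
  with p that show ?thesis by blast
qed

text \<open>\<open>g x y\<close> is the net flow from \<open>x\<close> to \<open>y\<close>. Skew
  symmetry turns the upper bound 1 into the lower bound -1, so an undirected edge has capacity one
  in either direction, and opposite flows cancel by themselves.\<close>

definition unit_flow :: "'v set set \<Rightarrow> ('v \<Rightarrow> 'v \<Rightarrow> int) \<Rightarrow> bool" where
  "unit_flow E g \<longleftrightarrow> (\<forall>x y. g y x = - g x y \<and> ({x, y} \<in> E \<or> g x y = 0) \<and> g x y \<le> 1)"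

lemma unit_flowD:
  assumes "unit_flow E g"
  shows "g y x = - g x y" "{x, y} \<in> E \<or> g x y = 0" "g x y \<le> 1"
  using assms unfolding unit_flow_def by blast+

definition arc_flow :: "'v \<Rightarrow> 'v \<Rightarrow> 'v \<Rightarrow> 'v \<Rightarrow> int" where
  "arc_flow x y u w = of_bool (u = x \<and> w = y) - of_bool (u = y \<and> w = x)"

fun path_flow :: "'v list \<Rightarrow> 'v \<Rightarrow> 'v \<Rightarrow> int" where
  "path_flow (x # y # p) u w = arc_flow x y u w + path_flow (y # p) u w"
| "path_flow p u w = 0"

lemma path_flow_net:
  assumes "finite V" "set p \<subseteq> V" "p \<noteq> []"
  shows "(\<Sum>w\<in>V. path_flow p u w) = of_bool (u = hd p) - of_bool (u = last p)"
  using assms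
proof (induction p rule: induct_list012)
  case (3 x y p)
  have "(\<Sum>w\<in>V. arc_flow x y u w) = (\<Sum>w\<in>V. if w = y then of_bool (u = x) else 0)
      - (\<Sum>w\<in>V. if w = x then of_bool (u = y) else 0)"
    unfolding arc_flow_def sum_subtractf[symmetric] by (intro sum.cong) auto
  also have "\<dots> = of_bool (u = x) - of_bool (u = y)"
    using 3 by simp
  finally show ?case using 3 by (simp add: sum.distrib)
qed auto

lemma path_flow_eq:
  assumes "distinct p"
  shows "path_flow p u w = of_bool ((u, w) \<in> arcs p) - of_bool ((w, u) \<in> arcs p)"
  using assms
proof (induction p rule: induct_list012)
  case (3 x y p)
  have "x \<noteq> y" "(x, y) \<notin> arcs (y # p)" "(y, x) \<notin> arcs (y # p)"
    using 3 arcs_subset[of _ _ "y # p"] by auto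
  with 3 show ?case by (auto simp: arc_flow_def)
qed auto

locale flow_network =
  fixes V :: "'v set" and E :: "'v set set" and A B :: "'v set"
  assumes finite_V: "finite V" and edges: "e \<in> E \<Longrightarrow> e \<subseteq> V \<and> card e = 2"
    and A_V: "A \<subseteq> V" and B_V: "B \<subseteq> V" and disjoint: "A \<inter> B = {}"
begin

definition net :: "('v \<Rightarrow> 'v \<Rightarrow> int) \<Rightarrow> 'v \<Rightarrow> int" where
  "net g x = (\<Sum>y\<in>V. g x y)"

definition flow_of_value :: "int \<Rightarrow> ('v \<Rightarrow> 'v \<Rightarrow> int) \<Rightarrow> bool" where
  "flow_of_value k g \<longleftrightarrow>
     unit_flow E g \<and> (\<forall>x\<in>V - A - B. net g x = 0) \<and> (\<Sum>x\<in>A. net g x) = k"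

text \<open>Arcs inside \<open>R\<close> cancel in pairs by skew symmetry, and vertices of
  \<open>R\<close> outside \<open>A\<close> have net flow 0, so what leaves \<open>A\<close> must
  cross the boundary of \<open>R\<close>.\<close>

lemma flow_across:
  assumes g: "flow_of_value k g" and R: "A \<subseteq> R" "R \<subseteq> V" "R \<inter> B = {}"
  shows "k = (\<Sum>x\<in>R. \<Sum>y\<in>V - R. g x y)"
proof -
  have fin: "finite R" "finite A" using R A_V finite_V by (auto intro: finite_subset)
  have inner: "(\<Sum>x\<in>R. \<Sum>y\<in>R. g x y) = 0"
  proof -
    have "(\<Sum>x\<in>R. \<Sum>y\<in>R. g x y) = (\<Sum>y\<in>R. \<Sum>x\<in>R. g x y)" by (rule sum.swap)
    also have "\<dots> = (\<Sum>y\<in>R. \<Sum>x\<in>R. - g y x)"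
      using g unfolding flow_of_value_def by (intro sum.cong refl unit_flowD(1)) blast
    finally show ?thesis by (simp add: sum_negf)
  qed
  have "k = (\<Sum>x\<in>A. net g x)" using g by (simp add: flow_of_value_def)
  also have "\<dots> = (\<Sum>x\<in>R. net g x)"
    using g R fin by (intro sum.mono_neutral_left) (auto simp: flow_of_value_def)
  also have "\<dots> = (\<Sum>x\<in>R. (\<Sum>y\<in>R. g x y) + (\<Sum>y\<in>V - R. g x y))"
    unfolding net_def
    using R finite_V by (intro sum.cong refl) (metis add.commute sum.subset_diff)
  also have "\<dots> = (\<Sum>x\<in>R. \<Sum>y\<in>V - R. g x y)" using inner by (simp add: sum.distrib)
  finally show ?thesis .
qed

text \<open>The set reached from \<open>A\<close> along \<open>P\<close> is closed under
  \<open>P\<close>, so it is a forbidden cut unless it meets \<open>B\<close>. \<open>P\<close> is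
  instantiated twice: with the arcs that have residual capacity to enlarge a flow, and with the arcs
  that carry a unit to take a path out of one.\<close>

lemma reachable_sink:
  assumes no_cut: "\<And>R. A \<subseteq> R \<Longrightarrow> R \<subseteq> V \<Longrightarrow> R \<inter> B = {} \<Longrightarrow>
      (\<And>x y. x \<in> R \<Longrightarrow> y \<in> V - R \<Longrightarrow> \<not> P x y) \<Longrightarrow> False"
    and P: "\<And>x y. P x y \<Longrightarrow> {x, y} \<in> E"
  obtains p where "graph_path (V, E) p" "hd p \<in> A" "last p \<in> B" "successively P p"
proof -
  define R where "R = {y \<in> V. \<exists>x\<in>A. (x, y) \<in> {(x, y). P x y}\<^sup>*}"
  have "R \<inter> B \<noteq> {}"
  proof
    assume "R \<inter> B = {}"
    moreover have "A \<subseteq> R" using A_V by (auto simp: R_def)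
    moreover have "\<not> P x y" if "x \<in> R" "y \<in> V - R" for x y
    proof
      assume "P x y"
      then have "(x, y) \<in> {(x, y). P x y}" by simp
      with that show False unfolding R_def by (blast intro: rtrancl.rtrancl_into_rtrancl)
    qed
    ultimately show False using no_cut[of R] by (auto simp: R_def)
  qed
  then obtain a b where ab: "a \<in> A" "b \<in> B" "(a, b) \<in> {(x, y). P x y}\<^sup>*"
    by (auto simp: R_def)
  have aV: "a \<in> V" and EV: "\<And>e. e \<in> E \<Longrightarrow> e \<subseteq> V" using ab A_V edges by auto
  obtain p where "graph_path (V, E) p" "hd p = a" "last p = b" "successively P p"
    using rtrancl_graph_path[OF ab(3) aV P EV] by blast
  with ab that show ?thesis by blast
qed

lemma net_add_path:
  assumes "graph_path (V, E) p"
  shows "net (\<lambda>x y. g x y + c * path_flow p x y) x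
       = net g x + c * (of_bool (x = hd p) - of_bool (x = last p))"
  using assms path_flow_net[OF finite_V, of p x]
  by (simp add: net_def graph_path_def sum.distrib sum_distrib_left[symmetric])

text \<open>Used with c = 1 for augmenting and with c = -1 for removing a path.\<close>

lemma flow_add_path:
  assumes g: "flow_of_value k g" and p: "graph_path (V, E) p" "hd p \<in> A" "last p \<in> B"
    and unit: "unit_flow E (\<lambda>x y. g x y + c * path_flow p x y)"
  shows "flow_of_value (k + c) (\<lambda>x y. g x y + c * path_flow p x y)"
proof -
  have fin: "finite A" using A_V finite_V finite_subset by blast
  have "last p \<notin> A" "hd p \<notin> B" using p disjoint by auto
  then have "(\<Sum>x\<in>A. net g x + c * (of_bool (x = hd p) - of_bool (x = last p)))
      = (\<Sum>x\<in>A. net g x + (if x = hd p then c else 0))"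
    by (intro sum.cong) auto
  also have "\<dots> = (\<Sum>x\<in>A. net g x) + c" using fin p by (simp add: sum.distrib)
  finally show ?thesis
    using g unit p \<open>hd p \<notin> B\<close> by (auto simp: flow_of_value_def net_add_path)
qed

lemma unit_flow_augment:
  assumes "unit_flow E g" "graph_path (V, E) p" "successively (\<lambda>x y. {x, y} \<in> E \<and> g x y \<le> 0) p"
  shows "unit_flow E (\<lambda>x y. g x y + 1 * path_flow p x y)"
proof -
  have p: "distinct p" and a: "\<And>x y. (x, y) \<in> arcs p \<Longrightarrow> {x, y} \<in> E \<and> g x y \<le> 0"
    using assms by (auto simp: graph_path_def successively_arcs)
  show ?thesis
    unfolding unit_flow_def
  proof (intro allI conjI)
    fix x y
    have g: "g y x = - g x y" "{x, y} \<in> E \<or> g x y = 0" "g x y \<le> 1"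
      using unit_flowD[OF assms(1)] by blast+
    show "g y x + 1 * path_flow p y x = - (g x y + 1 * path_flow p x y)"
      using p g by (simp add: path_flow_eq)
    show "{x, y} \<in> E \<or> g x y + 1 * path_flow p x y = 0"
      using p g a[of x y] a[of y x] by (auto simp: path_flow_eq insert_commute)
    show "g x y + 1 * path_flow p x y \<le> 1"
      using p g a[of x y] by (auto simp: path_flow_eq)
  qed
qed

text \<open>Ford-Fulkerson augmentation. If no augmenting path exists, every edge leaving the
  reached set carries a full unit, so the value k of the flow is the size of a cut, which is at
  least m > k.\<close>

lemma max_flow:
  assumes cut: "\<And>S. A \<subseteq> S \<Longrightarrow> S \<subseteq> V \<Longrightarrow> S \<inter> B = {} \<Longrightarrow> m \<le> card (edge_boundary E S)"
    and "k \<le> m"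
  shows "\<exists>g. flow_of_value (int k) g"
  using assms(2)
proof (induction k)
  case 0
  then show ?case
    by (intro exI[of _ "\<lambda>_ _. 0"]) (auto simp: flow_of_value_def unit_flow_def net_def)
next
  case (Suc k)
  then obtain g where g: "flow_of_value (int k) g" by auto
  then have u: "unit_flow E g" by (simp add: flow_of_value_def)
  obtain p where p: "graph_path (V, E) p" "hd p \<in> A" "last p \<in> B"
    "successively (\<lambda>x y. {x, y} \<in> E \<and> g x y \<le> 0) p"
  proof (rule reachable_sink)
    fix R assume R: "A \<subseteq> R" "R \<subseteq> V" "R \<inter> B = {}"
      and sat: "\<And>x y. x \<in> R \<Longrightarrow> y \<in> V - R \<Longrightarrow> \<not> ({x, y} \<in> E \<and> g x y \<le> 0)"
    define C where "C = {(x, y) \<in> R \<times> (V - R). {x, y} \<in> E}"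
    have finR: "finite R" using R finite_V finite_subset by blast
    have val: "g x y = of_bool ({x, y} \<in> E)" if "x \<in> R" "y \<in> V - R" for x y
    proof -
      have "g x y \<le> 1" "{x, y} \<in> E \<or> g x y = 0" using unit_flowD[OF u] by blast+
      then show ?thesis using sat[OF that] by (cases "{x, y} \<in> E") auto
    qed
    have "int k = (\<Sum>x\<in>R. \<Sum>y\<in>V - R. g x y)" using flow_across[OF g R] .
    also have "\<dots> = (\<Sum>(x, y)\<in>R \<times> (V - R). of_bool ({x, y} \<in> E))"
      by (simp add: sum.cartesian_product[symmetric] val)
    also have "\<dots> = (\<Sum>q\<in>R \<times> (V - R). if q \<in> C then 1 else 0)"
      by (intro sum.cong) (auto simp: C_def)
    also have "\<dots> = int (card C)"
    proof -
      have "(R \<times> (V - R)) \<inter> C = C" by (auto simp: C_def)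
      then show ?thesis using finR finite_V by (simp add: sum.If_cases)
    qed
    also have "card C = card ((\<lambda>(x, y). {x, y}) ` C)"
      by (rule card_image[symmetric]) (auto simp: inj_on_def C_def doubleton_eq_iff)
    also have "(\<lambda>(x, y). {x, y}) ` C = edge_boundary E R"
    proof
      show "(\<lambda>(x, y). {x, y}) ` C \<subseteq> edge_boundary E R"
        by (auto simp: C_def edge_boundary_def)
      show "edge_boundary E R \<subseteq> (\<lambda>(x, y). {x, y}) ` C"
      proof
        fix e assume e: "e \<in> edge_boundary E R"
        then have eE: "e \<in> E" "e \<subseteq> V" "card e = 2" using edges by (auto simp: edge_boundary_def)
        from e obtain x y where xy: "x \<in> e" "x \<in> R" "y \<in> e" "y \<notin> R"
          by (auto simp: edge_boundary_def)
        have "x \<noteq> y" using xy by blast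
        then have "{x, y} \<subseteq> e" "card {x, y} = 2" using xy by auto
        then have "e = {x, y}"
          by (metis eE(3) card_subset_eq card.infinite zero_neq_numeral)
        then show "e \<in> (\<lambda>(x, y). {x, y}) ` C" using xy eE by (auto simp: C_def)
      qed
    qed
    finally have "k = card (edge_boundary E R)" by simp
    with cut[OF R] Suc.prems show False by simp
  qed auto
  have "flow_of_value (int k + 1) (\<lambda>x y. g x y + 1 * path_flow p x y)"
    using flow_add_path[OF g p(1-3) unit_flow_augment[OF u p(1) p(4)]] .
  then show ?case by (metis of_nat_Suc add.commute)
qed

text \<open>While the value is positive, some path follows arcs of flow exactly 1, since otherwise
  no flow would leave the reached set. Removing it makes the flow vanish on its edges in both
  directions. That the paths run along arcs of flow 1 belongs to the claim because this makes the
  later paths avoid those edges.\<close>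

lemma flow_decomposition:
  assumes "flow_of_value (int k) g"
  shows "\<exists>p. (\<forall>i<k. graph_path (V, E) (p i) \<and> hd (p i) \<in> A \<and> last (p i) \<in> B \<and>
                  successively (\<lambda>x y. g x y = 1) (p i)) \<and>
             (\<forall>i<k. \<forall>j<k. i \<noteq> j \<longrightarrow> path_edges (p i) \<inter> path_edges (p j) = {})"
  using assms
proof (induction k arbitrary: g)
  case (Suc k)
  then have u: "unit_flow E g" by (simp add: flow_of_value_def)
  have gE: "{x, y} \<in> E" if "g x y = 1" for x y
    using unit_flowD(2)[OF u, of x y] that by simp
  obtain q where q: "graph_path (V, E) q" "hd q \<in> A" "last q \<in> B"
    "successively (\<lambda>x y. g x y = 1) q"
  proof (rule reachable_sink)
    fix R assume R: "A \<subseteq> R" "R \<subseteq> V" "R \<inter> B = {}"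
      and sat: "\<And>x y. x \<in> R \<Longrightarrow> y \<in> V - R \<Longrightarrow> g x y \<noteq> 1"
    have "int (Suc k) = (\<Sum>x\<in>R. \<Sum>y\<in>V - R. g x y)" using flow_across[OF Suc.prems R] .
    also have "\<dots> \<le> 0"
    proof (intro sum_nonpos)
      fix x y assume "x \<in> R" "y \<in> V - R"
      then have "g x y \<noteq> 1" "g x y \<le> 1" using sat unit_flowD(3)[OF u] by blast+
      then show "g x y \<le> 0" by simp
    qed
    finally show False by simp
  qed (auto intro: gE)
  define h where "h = (\<lambda>x y. g x y + (- 1) * path_flow q x y)"
  have dq: "distinct q" and aq: "\<And>x y. (x, y) \<in> arcs q \<Longrightarrow> g x y = 1"
    using q by (auto simp: graph_path_def successively_arcs)
  have anti: "g y x = - g x y" for x y using unit_flowD(1)[OF u] .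
  have h: "h x y = (if (x, y) \<in> arcs q \<or> (y, x) \<in> arcs q then 0 else g x y)" for x y
    using aq[of x y] aq[of y x] anti[of x y] arcs_asym[OF dq, of x y]
    by (auto simp: h_def path_flow_eq[OF dq])
  have "unit_flow E h"
    unfolding unit_flow_def
  proof (intro allI conjI)
    fix x y
    show "h y x = - h x y" "{x, y} \<in> E \<or> h x y = 0" "h x y \<le> 1"
      using anti[of x y] unit_flowD(2,3)[OF u, of x y] by (auto simp: h)
  qed
  then have "flow_of_value (int k) h"
    using flow_add_path[OF Suc.prems q(1-3), of "- 1"] by (simp add: h_def)
  from Suc.IH[OF this] obtain p where
    p: "\<And>i. i < k \<Longrightarrow> graph_path (V, E) (p i) \<and> hd (p i) \<in> A \<and> last (p i) \<in> B \<and>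
              successively (\<lambda>x y. h x y = 1) (p i)"
    and dis: "\<And>i j. i < k \<Longrightarrow> j < k \<Longrightarrow> i \<noteq> j \<Longrightarrow> path_edges (p i) \<inter> path_edges (p j) = {}"
    by blast
  have pg: "successively (\<lambda>x y. g x y = 1) (p i)" if "i < k" for i
    using p[OF that] by (auto simp: successively_arcs h split: if_splits)
  have new: "path_edges q \<inter> path_edges (p i) = {}" if "i < k" for i
  proof -
    have "(x, y) \<notin> arcs q \<and> (y, x) \<notin> arcs q" if "(x, y) \<in> arcs (p i)" for x y
      using p[OF \<open>i < k\<close>] that by (auto simp: successively_arcs h split: if_splits)
    then show ?thesis by (force simp: path_edges_arcs doubleton_eq_iff)
  qed
  define p' where "p' = p(k := q)"
  have "\<forall>i<Suc k. graph_path (V, E) (p' i) \<and> hd (p' i) \<in> A \<and> last (p' i) \<in> B \<and>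
                  successively (\<lambda>x y. g x y = 1) (p' i)"
    using p pg q by (auto simp: p'_def less_Suc_eq)
  moreover have "\<forall>i<Suc k. \<forall>j<Suc k. i \<noteq> j \<longrightarrow> path_edges (p' i) \<inter> path_edges (p' j) = {}"
    using dis new by (auto simp: p'_def less_Suc_eq)
  ultimately show ?case by blast
qed auto

end

theorem edge_menger:
  assumes "finite V" "\<And>e. e \<in> E \<Longrightarrow> e \<subseteq> V \<and> card e = 2" "A \<subseteq> V" "B \<subseteq> V" "A \<inter> B = {}"
    and cut: "\<And>S. A \<subseteq> S \<Longrightarrow> S \<subseteq> V \<Longrightarrow> S \<inter> B = {} \<Longrightarrow> m \<le> card (edge_boundary E S)"
  shows "edge_connected_to m (V, E) A B"
proof -
  interpret flow_network V E A B using assms by unfold_locales auto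
  obtain g where "flow_of_value (int m) g" using max_flow[of m m] cut by blast
  from flow_decomposition[OF this] show ?thesis unfolding edge_connected_to_def by metis
qed

section \<open>Cubic graphs with large cuts\<close>

text \<open>The values 3, 4, 5 are the numbers of edges leaving a vertex, an edge and an induced
  path on three vertices of a cubic graph. The value 0 exempts the empty set, and under
  \<open>min\<close> also the whole vertex set.\<close>

definition cut_bound :: "nat \<Rightarrow> nat" where
  "cut_bound s = (if s = 0 then 0 else min 5 (s + 2))"

lemma graph_cycle_neighbours:
  assumes c: "graph_cycle (V, E) c" and v: "v \<in> set c"
  obtains x y where "x \<in> set c" "y \<in> set c" "x \<noteq> y" "{v, x} \<in> E" "{v, y} \<in> E"
proof -
  let ?n = "length c"
  have n: "3 \<le> ?n" and d: "distinct c" and cl: "{c ! (?n - 1), c ! 0} \<in> E"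
    and s: "\<And>i. Suc i < ?n \<Longrightarrow> {c ! i, c ! Suc i} \<in> E"
    using c by (auto simp: graph_cycle_def graph_path_def last_conv_nth hd_conv_nth
        successively_conv_nth)
  obtain i where i: "i < ?n" "v = c ! i" using v by (auto simp: in_set_conv_nth)
  have neq: "c ! j \<noteq> c ! k" if "j < ?n" "k < ?n" "j \<noteq> k" for j k
    using d that by (simp add: nth_eq_iff_index_eq)
  consider "i = 0" | "i = ?n - 1" "0 < i" | "0 < i" "Suc i < ?n" using i by linarith
  then show ?thesis
  proof cases
    case 1
    then show ?thesis
      using that[of "c ! 1" "c ! (?n - 1)"] s[of 0] cl n i neq[of 1 "?n - 1"]
      by (auto simp: insert_commute)
  next
    case 2
    then have i': "Suc (i - 1) = i" "i - 1 \<noteq> 0" "i - 1 < ?n" "0 < ?n" using n by auto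
    show ?thesis
    proof (rule that)
      show "c ! 0 \<in> set c" "c ! (i - 1) \<in> set c" using i' by auto
      show "c ! 0 \<noteq> c ! (i - 1)" using neq[of 0 "i - 1"] i' by simp
      show "{v, c ! 0} \<in> E" using cl 2 i by simp
      show "{v, c ! (i - 1)} \<in> E" using s[of "i - 1"] i' i by (simp add: insert_commute)
    qed
  next
    case 3
    then have i': "Suc (i - 1) = i" "i - 1 < ?n" by auto
    show ?thesis
    proof (rule that)
      show "c ! Suc i \<in> set c" "c ! (i - 1) \<in> set c" using i' 3 by auto
      show "c ! Suc i \<noteq> c ! (i - 1)" using neq[of "Suc i" "i - 1"] i' 3 by simp
      show "{v, c ! Suc i} \<in> E" using s[of i] 3 i by simp
      show "{v, c ! (i - 1)} \<in> E" using s[of "i - 1"] i' i by (simp add: insert_commute)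
    qed
  qed
qed

lemma edge_connected_to_mono:
  assumes "k \<le> m" "edge_connected_to m G A B"
  shows "edge_connected_to k G A B"
proof -
  obtain p where "\<forall>i<m. graph_path G (p i) \<and> hd (p i) \<in> A \<and> last (p i) \<in> B"
    "\<forall>i<m. \<forall>j<m. i \<noteq> j \<longrightarrow> path_edges (p i) \<inter> path_edges (p j) = {}"
    using assms(2) by (auto simp: edge_connected_to_def)
  with assms(1) show ?thesis
    unfolding edge_connected_to_def by (intro exI[of _ p]) simp
qed

text \<open>Seven vertices leave at least three outside a cycle of length at most 4, so that the
  full bound 5 applies to its complement as well.\<close>

locale well_cut_cubic_graph =
  fixes V :: "'v set" and E :: "'v set set"
  assumes finite_V: "finite V" and edges: "e \<in> E \<Longrightarrow> e \<subseteq> V \<and> card e = 2"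
    and cubic: "v \<in> V \<Longrightarrow> card {e \<in> E. v \<in> e} = 3"
    and cut: "S \<subseteq> V \<Longrightarrow>
      min (cut_bound (card S)) (cut_bound (card (V - S))) \<le> card (edge_boundary E S)"
    and large: "7 \<le> card V"
begin

lemma finite_E: "finite E"
  using finite_V edges by (auto intro: finite_subset[of E "Pow V"])

text \<open>A component has empty boundary, so the cut condition makes it or its complement
  empty.\<close>

lemma connected: "connected_graph (V, E)"
  unfolding connected_graph_def fst_conv
proof (intro conjI ballI)
  show "V \<noteq> {}" using large by auto
  fix x y assume xy: "x \<in> V" "y \<in> V"
  define R where "R = {z \<in> V. (x, z) \<in> {(a, b). {a, b} \<in> E}\<^sup>*}"
  have closed: "e \<subseteq> R" if e: "e \<in> E" and meet: "e \<inter> R \<noteq> {}" for e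
  proof
    fix b assume b: "b \<in> e"
    obtain a where a: "a \<in> e" "a \<in> R" using meet by blast
    show "b \<in> R"
    proof (cases "a = b")
      case False
      have "finite e" using edges[OF e] by (metis card.infinite zero_neq_numeral)
      moreover have "{a, b} \<subseteq> e" "card {a, b} = card e" using a b False edges[OF e] by auto
      ultimately have "{a, b} = e" by (rule card_subset_eq)
      then show ?thesis
        using a b e edges[OF e] unfolding R_def by (auto intro: rtrancl.rtrancl_into_rtrancl)
    qed (use a in simp)
  qed
  have "edge_boundary E R = {}" using closed by (auto simp: edge_boundary_def)
  moreover have "R \<subseteq> V" by (auto simp: R_def)
  ultimately have "card R = 0 \<or> card (V - R) = 0"
    using cut[of R] by (auto simp: cut_bound_def min_def split: if_splits)
  then have "R = {} \<or> V - R = {}"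
    using finite_V \<open>R \<subseteq> V\<close> by (metis card_0_eq finite_Diff finite_subset)
  moreover have "x \<in> R" using xy by (auto simp: R_def)
  ultimately have "y \<in> R" using xy by blast
  then have "(x, y) \<in> {(a, b). {a, b} \<in> E}\<^sup>*" by (simp add: R_def)
  moreover have "e \<subseteq> V" if "e \<in> E" for e using edges[OF that] by blast
  ultimately obtain p where "graph_path (V, E) p" "hd p = x" "last p = y"
    using rtrancl_graph_path[of x y "\<lambda>a b. {a, b} \<in> E" V E] xy(1) by blast
  then show "\<exists>p. graph_path (V, E) p \<and> hd p = x \<and> last p = y" by blast
qed

text \<open>Every vertex of a cycle sends at most one edge out of it, so a cycle shorter than 5 is
  separated by a cut of fewer than 5 edges.\<close>
lemma cycle_length:
  assumes c: "graph_cycle (V, E) c"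
  shows "5 \<le> length c"
proof (rule ccontr)
  assume short: "\<not> 5 \<le> length c"
  let ?S = "set c"
  have S: "?S \<subseteq> V" "card ?S = length c" "3 \<le> length c"
    using c by (auto simp: graph_cycle_def graph_path_def distinct_card)
  have "card (edge_boundary E ?S) \<le> card (\<Union>v\<in>?S. {e \<in> edge_boundary E ?S. v \<in> e})"
    using finite_E by (intro card_mono) (auto simp: edge_boundary_def)
  also have "\<dots> \<le> (\<Sum>v\<in>?S. card {e \<in> edge_boundary E ?S. v \<in> e})"
    by (rule card_UN_le) simp
  also have "\<dots> \<le> (\<Sum>v\<in>?S. 1)"
  proof (rule sum_mono)
    fix v assume v: "v \<in> ?S"
    obtain x y where xy: "x \<in> ?S" "y \<in> ?S" "x \<noteq> y" "{v, x} \<in> E" "{v, y} \<in> E"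
      using graph_cycle_neighbours[OF c v] .
    then have ne: "{v, x} \<noteq> {v, y}" by (auto simp: doubleton_eq_iff)
    have "card {e \<in> edge_boundary E ?S. v \<in> e} \<le> card ({e \<in> E. v \<in> e} - {{v, x}, {v, y}})"
      using finite_E xy v by (intro card_mono) (auto simp: edge_boundary_def)
    also have "\<dots> = card {e \<in> E. v \<in> e} - card {{v, x}, {v, y}}"
      using finite_E xy by (intro card_Diff_subset) auto
    also have "\<dots> = 1" using cubic[of v] v S ne by auto
    finally show "card {e \<in> edge_boundary E ?S. v \<in> e} \<le> 1" .
  qed
  also have "\<dots> = length c" using S by simp
  finally have "card (edge_boundary E ?S) \<le> length c" .
  moreover have "3 \<le> card (V - ?S)" using S short large by (subst card_Diff_subset) auto
  ultimately show False using cut[OF S(1)] S short by (auto simp: cut_bound_def split: if_splits)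
qed

lemma girth: "5 \<le> graph_girth (V, E)"
  unfolding graph_girth_def
  by (rule INF_greatest) (auto dest: cycle_length simp: numeral_eq_enat)

text \<open>A set separating two disjoint cycles has at least three vertices on either side, hence a
  boundary of at least 5 edges, and Menger's theorem turns this into paths.\<close>

lemma cyclically_5_edge_connected: "cyclically_edge_connected 5 (V, E)"
  unfolding cyclically_edge_connected_def
proof (intro allI impI, elim conjE)
  fix c d assume c: "graph_cycle (V, E) c" and d: "graph_cycle (V, E) d"
    and cd: "set c \<inter> set d = {}"
  have sz: "set c \<subseteq> V" "set d \<subseteq> V" "3 \<le> card (set c)" "3 \<le> card (set d)"
    using c d by (auto simp: graph_cycle_def graph_path_def distinct_card)
  show "edge_connected_to 5 (V, E) (set c) (set d)"
  proof (rule edge_menger)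
    fix S assume S: "set c \<subseteq> S" "S \<subseteq> V" "S \<inter> set d = {}"
    have "card (set c) \<le> card S" "card (set d) \<le> card (V - S)"
      using S sz finite_V by (auto intro!: card_mono intro: finite_subset)
    then show "5 \<le> card (edge_boundary E S)"
      using cut[OF S(2)] sz by (auto simp: cut_bound_def)
  qed (use finite_V edges sz cd in auto)
qed

lemma snarkI:
  assumes "\<not> three_edge_colourable (V, E)"
  shows "snark (V, E)"
proof -
  have "cyclically_edge_connected 4 (V, E)"
    using cyclically_5_edge_connected
    by (auto simp: cyclically_edge_connected_def intro: edge_connected_to_mono[of 4 5])
  then show ?thesis
    using assms connected girth finite_V edges cubic
    by (simp add: snark_def simple_graph_def cubic_graph_def)
qed

end

section \<open>Poles and gluing\<close>

text \<open>The pole has the vertices below \<open>order\<close>. Its \<open>k\<close>-th dangling edge leads from the \<open>k\<close>-th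
  terminal to the outside vertex \<open>order + k\<close>, so that the edges keep their names when something is
  attached.\<close>
datatype pole = Pole (order: nat) (inner: "(nat \<times> nat) list") (terminals: "nat list")

definition shift :: "nat \<Rightarrow> (nat \<times> nat) list \<Rightarrow> (nat \<times> nat) list" where
  "shift n = map (map_prod ((+) n) ((+) n))"

definition pentagon :: "(nat \<times> nat) list" where
  "pentagon = [(0, 1), (1, 2), (2, 3), (3, 4), (0, 4)]"

definition pentagram :: "(nat \<times> nat) list" where
  "pentagram = [(0, 2), (2, 4), (1, 4), (1, 3), (0, 3)]"

definition open_edges :: "pole \<Rightarrow> (nat \<times> nat) list" where
  "open_edges X = inner X @ zip (terminals X) [order X..<order X + 5]"

definition closed_edges :: "pole \<Rightarrow> (nat \<times> nat) list" where
  "closed_edges X = open_edges X @ shift (order X) pentagon"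

text \<open>In a gluing, the first five vertices of the second pole receive the dangling edges of the
  first. The edges \<open>stubs\<close> stand for these, and \<open>test_edges\<close> completes a gadget to a closed graph
  by putting a pentagram in place of the first pole.\<close>
definition stubs :: "nat \<Rightarrow> (nat \<times> nat) list" where
  "stubs n = zip [n..<n + 5] [0..<5]"

definition test_edges :: "pole \<Rightarrow> (nat \<times> nat) list" where
  "test_edges K = closed_edges K @ stubs (order K + 5) @ shift (order K + 5) pentagram"

definition glue :: "pole \<Rightarrow> pole \<Rightarrow> pole" where
  "glue X K = Pole (order X + order K) (open_edges X @ shift (order X) (inner K))
     (map ((+) (order X)) (terminals K))"

text \<open>Writing the smaller end first excludes loops and makes \<open>ends\<close> injective on
  the edges, so lists of pairs can stand for simple graphs. \<open>5 \<le> order X\<close> provides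
  the vertices 0 to 4 that receive dangling edges in a gluing.\<close>

definition wf_pole :: "pole \<Rightarrow> bool" where
  "wf_pole X \<longleftrightarrow> 5 \<le> order X \<and> distinct (inner X) \<and> (\<forall>(a, b)\<in>set (inner X). a < b \<and> b < order X) \<and>
     length (terminals X) = 5 \<and> distinct (terminals X) \<and> set (terminals X) \<subseteq> {..<order X}"

section \<open>Cut sizes of edge lists and of the five edges of a seam\<close>

definition cut_size :: "(nat \<times> nat) list \<Rightarrow> nat set \<Rightarrow> nat" where
  "cut_size es S = length (filter (\<lambda>(a, b). (a \<in> S) \<noteq> (b \<in> S)) es)"

definition well_cut :: "nat \<Rightarrow> (nat \<times> nat) list \<Rightarrow> bool" where
  "well_cut n es \<longleftrightarrow> (\<forall>S\<subseteq>{..<n}.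
     min (cut_bound (card S)) (cut_bound (card ({..<n} - S))) \<le> cut_size es S)"

lemma upt_five: "[0..<5] = [0, 1, 2, 3, 4 :: nat]" "[n..<n + 5] = [n, n + 1, n + 2, n + 3, n + 4]"
  by (simp_all add: upt_rec)

lemma shift_simps [simp]:
  "shift n [] = []" "shift n (e # es) = (n + fst e, n + snd e) # shift n es"
  "shift n (es @ fs) = shift n es @ shift n fs"
  by (simp_all add: shift_def map_prod_def split_beta)

lemma shift_shift: "shift n (shift m es) = shift (n + m) es"
  by (induction es) (simp_all add: add.assoc)

lemma cut_size_simps [simp]:
  "cut_size [] S = 0"
  "cut_size (e # es) S = of_bool ((fst e \<in> S) \<noteq> (snd e \<in> S)) + cut_size es S"
  "cut_size (es @ fs) S = cut_size es S + cut_size fs S"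
  by (auto simp: cut_size_def split_beta)

lemma cut_size_cong:
  assumes "\<And>a b. (a, b) \<in> set es \<Longrightarrow> (a \<in> S \<longleftrightarrow> a \<in> T) \<and> (b \<in> S \<longleftrightarrow> b \<in> T)"
  shows "cut_size es S = cut_size es T"
  unfolding cut_size_def
proof (intro arg_cong[where f = length] filter_cong refl)
  fix e assume "e \<in> set es"
  then show "(case e of (a, b) \<Rightarrow> (a \<in> S) \<noteq> (b \<in> S)) = (case e of (a, b) \<Rightarrow> (a \<in> T) \<noteq> (b \<in> T))"
    using assms[of "fst e" "snd e"] by (simp add: split_beta)
qed

lemma cut_size_shift: "cut_size (shift n es) S = cut_size es {v. n + v \<in> S}"
  by (induction es) auto

text \<open>The Hamming distance on five positions. When \<open>p\<close> and \<open>q\<close>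
  collect the indices whose two ends on the seam lie in a set, it is the number of seam edges that
  the set cuts.\<close>

definition mismatches :: "nat set \<Rightarrow> nat set \<Rightarrow> nat" where
  "mismatches p q = length (filter (\<lambda>k. (k \<in> p) \<noteq> (k \<in> q)) [0..<5])"

lemma mismatches_sum: "mismatches p q = (\<Sum>k<5. of_bool ((k \<in> p) \<noteq> (k \<in> q)))"
proof -
  have "{..<5} = {0, 1, 2, 3, 4 :: nat}" by auto
  then show ?thesis by (simp add: mismatches_def upt_five)
qed

lemma mismatches_restrict [simp]: "mismatches p (q \<inter> {..<5}) = mismatches p q"
  unfolding mismatches_def by (intro arg_cong[where f = length] filter_cong refl) auto

lemma mismatches_commute: "mismatches p q = mismatches q p"
  by (simp add: mismatches_def eq_commute)

lemma mismatches_empty: "mismatches p {} = card (p \<inter> {..<5})"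
  by (simp add: mismatches_sum Int_commute)

lemma mismatches_all: "mismatches p {..<5} = 5 - card (p \<inter> {..<5})"
proof -
  have "mismatches p {..<5} + mismatches p {} = (\<Sum>k<5 :: nat. 1)"
    unfolding mismatches_sum sum.distrib[symmetric] by (intro sum.cong) auto
  then show ?thesis unfolding mismatches_empty by simp
qed

lemma mismatches_triangle: "card (p \<inter> {..<5}) \<le> card (q \<inter> {..<5}) + mismatches p q"
  unfolding mismatches_empty[symmetric] mismatches_sum sum.distrib[symmetric]
  by (intro sum_mono) auto

text \<open>A symmetric difference has the parity of the sum of the two sizes.\<close>

lemma mismatches_parity:
  assumes "card (p \<inter> {..<5}) = card (q \<inter> {..<5})"
  shows "mismatches p q \<noteq> 1"
proof -
  have "even (mismatches p q + (mismatches p {} + mismatches q {}))"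
    unfolding mismatches_sum sum.distrib[symmetric] by (intro dvd_sum) auto
  then show ?thesis using assms unfolding mismatches_empty by auto
qed

text \<open>A pair of indices is joined either in the pentagon or in the pentagram. This excludes
  4-cycles across a gluing.\<close>
lemma pentagon_or_pentagram:
  assumes "card (q \<inter> {..<5}) \<in> {2, 3}"
  shows "cut_size pentagon q = 2 \<or> cut_size pentagram q = 2"
  using assms unfolding mismatches_empty[symmetric] mismatches_def pentagon_def pentagram_def upt_five
  by (cases "0 \<in> q"; cases "1 \<in> q"; cases "2 \<in> q"; cases "3 \<in> q"; cases "4 \<in> q"; simp)

text \<open>\<open>A\<close> is the pole and \<open>B\<close> the part attached to it:
  \<open>s\<close> counts chosen vertices, \<open>d\<close> cut edges inside, \<open>p\<close> and
  \<open>q\<close> the chosen ends of seam edges, \<open>c\<close> the cut seam edges. Each part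
  meets its own bound if all seam edges at chosen vertices are counted as cut. If p or q is at most
  1, then p + q \<le> c + 2, which the sum of the two bounds can afford. This leaves p = q = 2,
  where c = 0 would allow the four edges leaving a 4-cycle across the seam; the last premise
  excludes that.\<close>

lemma small_cut_arithmetic:
  fixes dA dB c sA sB p q :: nat
  assumes "sA \<le> 2" "sB \<le> 2" "cut_bound sA \<le> dA + p" "cut_bound sB \<le> dB + q"
    and "p \<le> sA" "q \<le> sB" "p \<le> q + c" "q \<le> p + c" "p = q \<longrightarrow> c \<noteq> 1"
    and "c = 0 \<and> p = 2 \<and> q = 2 \<longrightarrow> 3 \<le> dA \<or> 3 \<le> dB"
  shows "cut_bound (sA + sB) \<le> dA + c + dB"
proof -
  have cb: "cut_bound s = s + 2" if "1 \<le> s" "s \<le> 2" for s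
    using that by (simp add: cut_bound_def)
  have sum: "cut_bound (sA + sB) \<le> 5" "cut_bound (sA + sB) \<le> sA + sB + 2"
    by (simp_all add: cut_bound_def)
  consider "sA = 0" | "sB = 0" | "1 \<le> sA" "1 \<le> sB" "p = 2" "q = 2"
    | "1 \<le> sA" "1 \<le> sB" "p \<le> 1 \<or> q \<le> 1"
    using assms by linarith
  then show ?thesis
  proof cases
    case 1
    then show ?thesis using assms by simp
  next
    case 2
    then show ?thesis using assms by simp
  next
    case 3
    then have "4 \<le> dA + 2" "4 \<le> dB + 2" using assms cb[of sA] cb[of sB] by linarith+
    moreover have "c = 0 \<or> 2 \<le> c" using assms 3 by linarith
    ultimately have "5 \<le> dA + c + dB" using assms(10) 3 by linarith
    then show ?thesis using sum by linarith
  next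
    case 4
    then have "sA + 2 \<le> dA + p" "sB + 2 \<le> dB + q" using assms cb[of sA] cb[of sB] by linarith+
    then show ?thesis using assms(7,8) 4 sum by linarith
  qed
qed

text \<open>Here \<open>r\<close> counts the vertices outside the chosen set. If the two parts have
  three vertices on opposite sides, say \<open>rA\<close> and \<open>sB\<close>, then the cut has at
  least p + c + (5 - q) \<ge> 5 edges. Otherwise both parts are small on the same side, and
  \<open>small_cut_arithmetic\<close> applies to that side, with 5 - p and 5 - q for the
  outside.\<close>

lemma cut_arithmetic:
  fixes dA dB c sA rA sB rB p q :: nat
  assumes "cut_bound sA \<le> dA + p" "cut_bound rA \<le> dA + (5 - p)"
    and "cut_bound sB \<le> dB + q" "cut_bound rB \<le> dB + (5 - q)"
    and "p \<le> sA" "5 - p \<le> rA" "q \<le> sB" "5 - q \<le> rB" "p \<le> 5" "q \<le> 5"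
    and "p \<le> q + c" "q \<le> p + c" "p = q \<longrightarrow> c \<noteq> 1"
    and "c = 0 \<and> q \<in> {2, 3} \<longrightarrow> 3 \<le> dA \<or> 3 \<le> dB"
  shows "min (cut_bound (sA + sB)) (cut_bound (rA + rB)) \<le> dA + c + dB"
proof -
  \<comment> \<open>Of five seam ends at least three lie on one side, so each part is large on some
    side.\<close>
  have big: "3 \<le> sA \<or> 3 \<le> rA" "3 \<le> sB \<or> 3 \<le> rB" using assms by linarith+
  have cb: "cut_bound s = 5" if "3 \<le> s" for s using that by (simp add: cut_bound_def)
  have cb5: "cut_bound s \<le> 5" for s by (simp add: cut_bound_def)
  consider (A) "3 \<le> sA" "3 \<le> rA" | (B) "3 \<le> sB" "3 \<le> rB" | (lo_hi) "sA \<le> 2" "rB \<le> 2"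
    | (hi_lo) "rA \<le> 2" "sB \<le> 2" | (lo) "sA \<le> 2" "sB \<le> 2" | (hi) "rA \<le> 2" "rB \<le> 2"
    by linarith
  then have "5 \<le> dA + c + dB \<or> cut_bound (sA + sB) \<le> dA + c + dB \<or>
      cut_bound (rA + rB) \<le> dA + c + dB"
  proof cases
    case A
    then show ?thesis using assms big cb[of sA] cb[of rA] cb[of sB] cb[of rB] by linarith
  next
    case B
    then show ?thesis using assms big cb[of sA] cb[of rA] cb[of sB] cb[of rB] by linarith
  next
    case lo_hi
    then show ?thesis using assms big cb[of rA] cb[of sB] by linarith
  next
    case hi_lo
    then show ?thesis using assms big cb[of sA] cb[of rB] by linarith
  next
    case lo
    have "cut_bound (sA + sB) \<le> dA + c + dB"
      using assms lo by (intro small_cut_arithmetic[of sA sB dA p dB q]) auto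
    then show ?thesis by blast
  next
    case hi
    have "cut_bound (rA + rB) \<le> dA + c + dB"
    proof (rule small_cut_arithmetic)
      show "5 - p = 5 - q \<longrightarrow> c \<noteq> 1" using assms(9,10,13) by auto
      show "c = 0 \<and> 5 - p = 2 \<and> 5 - q = 2 \<longrightarrow> 3 \<le> dA \<or> 3 \<le> dB"
        using assms(9,10,14) by auto
    qed (use assms hi in linarith)+
    then show ?thesis by blast
  qed
  then show ?thesis using cb5[of "sA + sB"] cb5[of "rA + rB"] by linarith
qed

section \<open>Cuts of closed and glued poles\<close>

lemma well_cutD:
  "well_cut n es \<Longrightarrow> S \<subseteq> {..<n} \<Longrightarrow> min (cut_bound (card S)) (cut_bound (n - card S)) \<le> cut_size es S"
  unfolding well_cut_def by (metis card_Diff_subset card_lessThan finite_lessThan finite_subset)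

definition terminal_set :: "pole \<Rightarrow> nat set \<Rightarrow> nat set" where
  "terminal_set X U = {k. k < 5 \<and> terminals X ! k \<in> U}"

lemma cut_size_terminals:
  assumes "length (terminals X) = 5"
    and "\<And>k. k < 5 \<Longrightarrow> terminals X ! k \<in> S \<longleftrightarrow> terminals X ! k \<in> U"
    and "\<And>k. k < 5 \<Longrightarrow> n + k \<in> S \<longleftrightarrow> k \<in> T"
  shows "cut_size (zip (terminals X) [n..<n + 5]) S = mismatches (terminal_set X U) T"
proof -
  obtain t0 t1 t2 t3 t4 where t: "terminals X = [t0, t1, t2, t3, t4]"
    using assms(1) by (auto simp: numeral_eq_Suc length_Suc_conv)
  show ?thesis
    using assms(2)[of 0] assms(2)[of 1] assms(2)[of 2] assms(2)[of 3] assms(2)[of 4]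
      assms(3)[of 0] assms(3)[of 1] assms(3)[of 2] assms(3)[of 3] assms(3)[of 4]
    by (simp add: mismatches_def upt_five terminal_set_def t)
qed

lemma cut_size_stubs:
  assumes "\<And>k. k < 5 \<Longrightarrow> n + k \<in> S \<longleftrightarrow> k \<in> T" "\<And>k. k < 5 \<Longrightarrow> k \<in> S \<longleftrightarrow> k \<in> W"
  shows "cut_size (stubs n) S = mismatches T W"
  using assms(1)[of 0] assms(1)[of 1] assms(1)[of 2] assms(1)[of 3] assms(1)[of 4]
    assms(2)[of 0] assms(2)[of 1] assms(2)[of 2] assms(2)[of 3] assms(2)[of 4]
  by (simp add: stubs_def mismatches_def upt_five)

lemma card_shifted:
  assumes "finite T" "U \<subseteq> {..<n :: nat}"
  shows "card (U \<union> (+) n ` T) = card U + card T"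
proof -
  have "card (U \<union> (+) n ` T) = card U + card ((+) n ` T)"
    using assms by (intro card_Un_disjoint) (auto intro: finite_subset)
  then show ?thesis by (simp add: card_image)
qed

lemma open_edges_bounds:
  assumes "wf_pole X" "(a, b) \<in> set (open_edges X)"
  shows "a < b" "a < order X" "b < order X + 5"
proof -
  have "a < b \<and> a < order X \<and> b < order X + 5"
  proof (cases "(a, b) \<in> set (inner X)")
    case True
    then show ?thesis using assms by (fastforce simp: wf_pole_def)
  next
    case False
    then have "(a, b) \<in> set (zip (terminals X) [order X..<order X + 5])"
      using assms by (simp add: open_edges_def)
    then have "a \<in> set (terminals X)" "b \<in> set [order X..<order X + 5]"
      by (auto dest: set_zip_leftD set_zip_rightD)
    then show ?thesis using assms by (auto simp: wf_pole_def)
  qed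
  then show "a < b" "a < order X" "b < order X + 5" by auto
qed

lemma closed_edges_bounds:
  assumes "wf_pole X" "(a, b) \<in> set (closed_edges X)"
  shows "a < b" "b < order X + 5"
  using assms open_edges_bounds[of X a b]
  by (auto simp: closed_edges_def pentagon_def)

text \<open>A given part \<open>U\<close> of the pole is completed by an arbitrary part
  \<open>T\<close> of the closing cycle. The freedom in \<open>T\<close> is the point: different
  choices yield different lower bounds for the edges cut by \<open>U\<close>.
  \<open>test_cut\<close> is the counterpart for a gadget, with the pentagram in the role of the
  first pole.\<close>

lemma closed_cut:
  assumes X: "wf_pole X" and cut: "well_cut (order X + 5) (closed_edges X)"
    and U: "U \<subseteq> {..<order X}" and T: "T \<subseteq> {..<5}"
  shows "min (cut_bound (card U + card T)) (cut_bound (order X - card U + (5 - card T)))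
    \<le> cut_size (inner X) U + mismatches (terminal_set X U) T + cut_size pentagon T"
proof -
  let ?n = "order X"
  let ?S = "U \<union> (+) ?n ` T"
  have fT: "finite T" using T finite_subset by blast
  have card: "card ?S = card U + card T" using card_shifted[OF fT U] .
  have le: "card U \<le> ?n" "card T \<le> 5"
    using card_mono[OF _ U] card_mono[OF _ T] by simp_all
  have shifted: "?n + k \<in> ?S \<longleftrightarrow> k \<in> T" for k using U by auto
  have low: "a \<in> ?S \<longleftrightarrow> a \<in> U" if "a < ?n" for a using that by auto
  have "cut_size (inner X) ?S = cut_size (inner X) U"
    using X low by (intro cut_size_cong) (fastforce simp: wf_pole_def)
  moreover have "cut_size (zip (terminals X) [?n..<?n + 5]) ?S = mismatches (terminal_set X U) T"
    using X low shifted by (intro cut_size_terminals) (auto simp: wf_pole_def subset_eq)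
  moreover have "cut_size (shift ?n pentagon) ?S = cut_size pentagon T"
    using shifted by (simp add: cut_size_shift)
  ultimately have "cut_size (closed_edges X) ?S =
      cut_size (inner X) U + mismatches (terminal_set X U) T + cut_size pentagon T"
    by (simp add: closed_edges_def open_edges_def)
  moreover have "?S \<subseteq> {..<?n + 5}" using U T by auto
  moreover have "?n + 5 - card ?S = ?n - card U + (5 - card T)" using card le by simp
  ultimately show ?thesis using well_cutD[OF cut, of ?S] card by simp
qed

lemma test_cut:
  assumes K: "wf_pole K" and cut: "well_cut (order K + 10) (test_edges K)"
    and W: "W \<subseteq> {..<order K + 5}" and T: "T \<subseteq> {..<5}"
  shows "min (cut_bound (card W + card T)) (cut_bound (order K + 5 - card W + (5 - card T)))
    \<le> cut_size (closed_edges K) W + mismatches T W + cut_size pentagram T"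
proof -
  let ?n = "order K + 5"
  let ?S = "W \<union> (+) ?n ` T"
  have fT: "finite T" using T finite_subset by blast
  have card: "card ?S = card W + card T" using card_shifted[OF fT W] .
  have le: "card W \<le> ?n" "card T \<le> 5"
    using card_mono[OF _ W] card_mono[OF _ T] by simp_all
  have shifted: "?n + k \<in> ?S \<longleftrightarrow> k \<in> T" for k using W by auto
  have low: "a \<in> ?S \<longleftrightarrow> a \<in> W" if "a < ?n" for a using that by auto
  have "a < ?n \<and> b < ?n" if "(a, b) \<in> set (closed_edges K)" for a b
    using closed_edges_bounds[OF K that] by simp
  then have "cut_size (closed_edges K) ?S = cut_size (closed_edges K) W"
    using low by (intro cut_size_cong) blast
  moreover have "cut_size (stubs ?n) ?S = mismatches T W"
    using K shifted low by (intro cut_size_stubs) (auto simp: wf_pole_def)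
  moreover have "cut_size (shift ?n pentagram) ?S = cut_size pentagram T"
    using shifted by (simp add: cut_size_shift)
  ultimately have "cut_size (test_edges K) ?S =
      cut_size (closed_edges K) W + mismatches T W + cut_size pentagram T"
    by (simp add: test_edges_def)
  moreover have "?S \<subseteq> {..<order K + 10}" using W T by auto
  moreover have "order K + 10 - card ?S = ?n - card W + (5 - card T)" using card le by simp
  ultimately show ?thesis using well_cutD[OF cut, of ?S] card by simp
qed

lemma card_terminal_set:
  assumes "wf_pole X" "U \<subseteq> {..<order X}"
  shows "card (terminal_set X U) \<le> card U"
    and "5 - card (terminal_set X U) \<le> order X - card U"
proof -
  have inj: "inj_on ((!) (terminals X)) {..<5}"
    using assms by (auto simp: wf_pole_def inj_on_def nth_eq_iff_index_eq)
  have t: "terminals X ! k < order X" if "k < 5" for k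
    using assms that by (auto simp: wf_pole_def subset_eq)
  have fin: "finite U" using assms finite_subset by blast
  show "card (terminal_set X U) \<le> card U"
    using fin inj by (intro card_inj_on_le[of "(!) (terminals X)"])
      (auto simp: terminal_set_def intro: inj_on_subset)
  have "card ({..<5} - terminal_set X U) \<le> card ({..<order X} - U)"
    using t inj by (intro card_inj_on_le[of "(!) (terminals X)"])
      (auto simp: terminal_set_def intro: inj_on_subset)
  moreover have "terminal_set X U \<subseteq> {..<5}" by (auto simp: terminal_set_def)
  ultimately show "5 - card (terminal_set X U) \<le> order X - card U"
    using assms fin by (simp add: card_Diff_subset finite_subset)
qed

lemma open_edges_glue: "open_edges (glue X K) = open_edges X @ shift (order X) (open_edges K)"
proof -
  have upt: "[n + m..<n + m + 5] = map ((+) n) [m..<m + 5]" for n m :: nat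
    by (simp add: upt_five)
  show ?thesis
    unfolding open_edges_def[of "glue X K"]
    by (simp add: glue_def open_edges_def[of K] upt shift_def zip_map_map map_prod_def)
qed

lemma closed_edges_glue:
  "closed_edges (glue X K) = open_edges X @ shift (order X) (closed_edges K)"
  by (simp add: closed_edges_def[of "glue X K"] closed_edges_def[of K] open_edges_glue
      shift_shift) (simp add: glue_def)

text \<open>A set in the glued graph is split at the seam, and each part is completed to a cut of a
  smaller graph that is already known: the left part in the closure by a pentagon, the right part in
  the gadget completed by a pentagram.\<close>

lemma well_cut_glue:
  assumes X: "wf_pole X" "well_cut (order X + 5) (closed_edges X)"
    and K: "wf_pole K" "well_cut (order K + 10) (test_edges K)"
  shows "well_cut (order (glue X K) + 5) (closed_edges (glue X K))"
  unfolding well_cut_def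
proof (intro allI impI)
  let ?n = "order X" and ?m = "order K + 5"
  fix S assume "S \<subseteq> {..<order (glue X K) + 5}"
  then have S: "S \<subseteq> {..<?n + ?m}" by (simp add: glue_def add.assoc)
  define U where "U = S \<inter> {..<?n}"
  define W where "W = {v. ?n + v \<in> S}"
  have U: "U \<subseteq> {..<?n}" and W: "W \<subseteq> {..<?m}" using S by (auto simp: U_def W_def)
  have fin: "finite U" "finite W" using U W finite_subset by blast+
  have "S = U \<union> (+) ?n ` W"
  proof
    show "S \<subseteq> U \<union> (+) ?n ` W"
    proof
      fix x assume "x \<in> S"
      show "x \<in> U \<union> (+) ?n ` W"
      proof (cases "x < ?n")
        case False
        then have "x = ?n + (x - ?n)" by simp
        with \<open>x \<in> S\<close> have "x - ?n \<in> W" by (simp add: W_def)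
        with \<open>x = ?n + (x - ?n)\<close> show ?thesis by blast
      qed (use \<open>x \<in> S\<close> in \<open>simp add: U_def\<close>)
    qed
  qed (auto simp: U_def W_def)
  then have cS: "card S = card U + card W" using card_shifted[OF fin(2) U] by simp
  have le: "card U \<le> ?n" "card W \<le> ?m"
    using card_mono[OF _ U] card_mono[OF _ W] by simp_all
  define p where "p = terminal_set X U"
  define q where "q = W \<inter> {..<5}"
  have p: "p \<inter> {..<5} = p" "p \<subseteq> {..<5}" and q: "q \<inter> {..<5} = q" "q \<subseteq> {..<5}"
    by (auto simp: p_def terminal_set_def q_def)
  have mq: "mismatches p W = mismatches p q" for p by (simp add: q_def)
  have cp: "card p \<le> 5" and cq: "card q \<le> 5"
    using card_mono[OF _ p(2)] card_mono[OF _ q(2)] by simp_all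
  have cut: "cut_size (closed_edges (glue X K)) S =
      cut_size (inner X) U + mismatches p q + cut_size (closed_edges K) W"
  proof -
    have "cut_size (inner X) S = cut_size (inner X) U"
      using X(1) by (intro cut_size_cong) (fastforce simp: wf_pole_def U_def)
    moreover have "cut_size (zip (terminals X) [?n..<?n + 5]) S = mismatches p W"
      unfolding p_def using X(1)
      by (intro cut_size_terminals) (auto simp: wf_pole_def U_def W_def subset_eq)
    moreover have "cut_size (shift ?n (closed_edges K)) S = cut_size (closed_edges K) W"
      by (simp add: cut_size_shift W_def)
    ultimately show ?thesis by (simp add: closed_edges_glue open_edges_def mq)
  qed
  have z: "cut_size es {} = 0" for es by (simp add: cut_size_def)
  have five: "cut_size pentagon {..<5} = 0" "cut_size pentagram {..<5} = 0"
    by (simp_all add: pentagon_def pentagram_def)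
  have cb: "cut_bound (x + 5) = 5" "cut_bound x \<le> 5" for x by (simp_all add: cut_bound_def)
  have "min (cut_bound (card U + card W)) (cut_bound (?n - card U + (?m - card W)))
      \<le> cut_size (inner X) U + mismatches p q + cut_size (closed_edges K) W"
  \<comment> \<open>The 5-cycle is put entirely outside (\<open>{}\<close>) or inside
    (\<open>{..<5}\<close>). Then none of its edges is cut, and its five vertices raise the bound of
    the side that holds them to 5, so the minimum is the bound of the other side.\<close>
  proof (rule cut_arithmetic[where p = "card p" and q = "card q"])
    show "cut_bound (card U) \<le> cut_size (inner X) U + card p"
      using closed_cut[OF X U, of "{}"] cb mismatches_empty[of p]
      by (simp add: z p min_absorb1 flip: p_def)
    show "cut_bound (?n - card U) \<le> cut_size (inner X) U + (5 - card p)"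
      using closed_cut[OF X U, of "{..<5}"] cb mismatches_all[of p]
      by (simp add: five p min_absorb2 flip: p_def)
    show "cut_bound (card W) \<le> cut_size (closed_edges K) W + card q"
      using test_cut[OF K W, of "{}"] cb mismatches_empty[of q] mq[of "{}"]
        mismatches_commute[of "{}" q]
      by (simp add: z q min_absorb1)
    show "cut_bound (?m - card W) \<le> cut_size (closed_edges K) W + (5 - card q)"
      using test_cut[OF K W, of "{..<5}"] cb mismatches_all[of q] mq[of "{..<5}"]
        mismatches_commute[of "{..<5}" q]
      by (simp add: five q min_absorb2)
    show "card p \<le> card U" "5 - card p \<le> ?n - card U"
      unfolding p_def using card_terminal_set[OF X(1) U] .
    show "card q \<le> card W" unfolding q_def using fin by (intro card_mono) auto
    have "card ({..<5} - q) \<le> card ({..<?m} - W)"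
      using K(1) by (intro card_mono) (auto simp: q_def wf_pole_def)
    then show "5 - card q \<le> ?m - card W"
      using q W fin by (simp add: card_Diff_subset finite_subset)
    show "card p \<le> 5" "card q \<le> 5" by fact+
    show "card p \<le> card q + mismatches p q" "card q \<le> card p + mismatches p q"
      using mismatches_triangle[of p q] mismatches_triangle[of q p]
      by (simp_all add: p q mismatches_commute)
    show "card p = card q \<longrightarrow> mismatches p q \<noteq> 1"
      using mismatches_parity[of p q] by (simp add: p q)
    show "mismatches p q = 0 \<and> card q \<in> {2, 3} \<longrightarrow>
        3 \<le> cut_size (inner X) U \<or> 3 \<le> cut_size (closed_edges K) W"
    proof (intro impI, elim conjE)
      assume m: "mismatches p q = 0" and c: "card q \<in> {2, 3}"
      have "card p = card q"
        using mismatches_triangle[of p q] mismatches_triangle[of q p] m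
        by (simp add: p q mismatches_commute)
      have "p = q"
        using m p(2) q(2) unfolding mismatches_sum by auto
      \<comment> \<open>With no seam edge cut, the same indices are chosen on both sides. Choosing
        them on each added 5-cycle too leaves the seams there uncut and puts at least 2 + 2 vertices
        on each side, so both completed cuts have 5 edges. One of the 5-cycles contributes only 2 of
        them.\<close>
      have bd: "cut_bound x = 5" if "4 \<le> x" for x using that by (simp add: cut_bound_def)
      have qW: "card q \<le> card W" "5 - card q \<le> ?m - card W" by fact+
      have pU: "card p \<le> card U" "5 - card p \<le> ?n - card U" by fact+
      have "5 \<le> cut_size (inner X) U + cut_size pentagon q"
        using closed_cut[OF X U q(2)] c pU \<open>card p = card q\<close> m
        by (auto simp: bd simp flip: p_def)
      moreover have "5 \<le> cut_size (closed_edges K) W + cut_size pentagram q"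
        using test_cut[OF K W q(2)] c qW m mq \<open>p = q\<close> by (auto simp: bd)
      ultimately show "3 \<le> cut_size (inner X) U \<or> 3 \<le> cut_size (closed_edges K) W"
        using pentagon_or_pentagram[of q] c by (auto simp: q)
    qed
  qed
  moreover have "card ({..<order (glue X K) + 5} - S) = ?n - card U + (?m - card W)"
    using S cS le finite_subset[OF S] by (simp add: card_Diff_subset glue_def add.assoc)
  ultimately show "min (cut_bound (card S)) (cut_bound (card ({..<order (glue X K) + 5} - S)))
      \<le> cut_size (closed_edges (glue X K)) S"
    by (simp add: cS cut)
qed

section \<open>Colourings of poles\<close>

fun meets :: "nat \<times> nat \<Rightarrow> nat \<times> nat \<Rightarrow> bool" where
  "meets (a, b) (c, d) \<longleftrightarrow> a = c \<or> a = d \<or> b = c \<or> b = d"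

definition conflict_free :: "(nat \<times> nat) \<times> nat \<Rightarrow> (nat \<times> nat) \<times> nat \<Rightarrow> bool" where
  "conflict_free x y \<longleftrightarrow> (meets (fst x) (fst y) \<longrightarrow> snd x \<noteq> snd y)"

definition compatible :: "((nat \<times> nat) \<times> nat) list \<Rightarrow> ((nat \<times> nat) \<times> nat) list \<Rightarrow> bool" where
  "compatible A B \<longleftrightarrow> (\<forall>x\<in>set A. \<forall>y\<in>set B. conflict_free x y)"

definition proper :: "(nat \<times> nat) list \<Rightarrow> nat list \<Rightarrow> bool" where
  "proper es cs \<longleftrightarrow>
     length cs = length es \<and> set cs \<subseteq> {..<3} \<and> sorted_wrt conflict_free (zip es cs)"

text \<open>Backtracking instead of filtering all colour lists keeps the evaluation of
  \<open>transfer\<close> feasible. \<open>A\<close> holds precoloured edges; conflicts inside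
  \<open>A\<close> are not examined.\<close>

fun extensions :: "((nat \<times> nat) \<times> nat) list \<Rightarrow> (nat \<times> nat) list \<Rightarrow> nat list list" where
  "extensions A [] = [[]]"
| "extensions A (e # es) = (let F = map snd (filter (\<lambda>x. meets e (fst x)) A) in
     concat (map (\<lambda>c. if List.member F c then [] else map ((#) c) (extensions ((e, c) # A) es))
       [0, 1, 2]))"

lemma meets_commute: "meets e f \<longleftrightarrow> meets f e"
  by (cases e; cases f) auto

lemma compatible_simps [simp]:
  "compatible [] B" "compatible A []"
  "compatible (A @ A') B \<longleftrightarrow> compatible A B \<and> compatible A' B"
  "compatible A (B @ B') \<longleftrightarrow> compatible A B \<and> compatible A B'"
  by (auto simp: compatible_def)

lemma proper_append:
  assumes "length cs = length es"
  shows "proper (es @ fs) (cs @ ds) \<longleftrightarrow>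
    proper es cs \<and> proper fs ds \<and> compatible (zip es cs) (zip fs ds)"
  using assms by (auto simp: proper_def sorted_wrt_append compatible_def)

lemma proper_Cons:
  "proper (e # es) (c # cs) \<longleftrightarrow> c < 3 \<and> proper es cs \<and> compatible [(e, c)] (zip es cs)"
  using proper_append[of "[c]" "[e]" es cs] by (auto simp: proper_def)

lemma in_extensions: "cs \<in> set (extensions A es) \<longleftrightarrow> proper es cs \<and> compatible A (zip es cs)"
proof (induction es arbitrary: A cs)
  case Nil
  then show ?case by (auto simp: proper_def)
next
  case (Cons e es)
  have three: "c \<in> set [0, 1, 2] \<longleftrightarrow> c < 3" for c :: nat by auto
  have free: "List.member (map snd (filter (\<lambda>x. meets e (fst x)) A)) c \<longleftrightarrow> \<not> compatible A [(e, c)]" for c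
    by (force simp: compatible_def conflict_free_def meets_commute[of e])
  have "cs \<in> set (extensions A (e # es)) \<longleftrightarrow> (\<exists>c\<in>set [0, 1, 2]. \<exists>ds. cs = c # ds \<and>
      compatible A [(e, c)] \<and> ds \<in> set (extensions ((e, c) # A) es))"
    unfolding extensions.simps Let_def free set_concat set_map by (auto split: if_splits)
  also have "\<dots> \<longleftrightarrow> (\<exists>c ds. c < 3 \<and> cs = c # ds \<and>
      compatible A [(e, c)] \<and> proper es ds \<and> compatible ((e, c) # A) (zip es ds))"
    unfolding three Bex_def Cons.IH by auto
  also have "\<dots> \<longleftrightarrow> proper (e # es) cs \<and> compatible A (zip (e # es) cs)"
  proof (cases cs)
    case Nil
    then show ?thesis by (simp add: proper_def)
  next
    case (Cons c ds)
    then show ?thesis by (auto simp: proper_Cons compatible_def)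
  qed
  finally show ?case .
qed

lemma distinct_extensions: "distinct (extensions A es)"
proof (induction es arbitrary: A)
  case (Cons e es)
  then show ?case by (auto simp: Let_def distinct_map)
qed simp

lemma finite_proper: "finite {cs. proper es cs}"
  by (rule finite_subset[OF _ finite_lists_length_eq[of "{..<3}" "length es"]])
    (auto simp: proper_def)

text \<open>Before rotation, the two singly coloured edges are in positions 0 and 2.\<close>
definition star_patterns :: "nat list list" where
  "star_patterns = concat (map (\<lambda>k. map (rotate k)
     [[0, 2, 1, 2, 2], [1, 2, 0, 2, 2], [0, 1, 2, 1, 1], [2, 1, 0, 1, 1],
      [1, 0, 2, 0, 0], [2, 0, 1, 0, 0]]) [0..<5])"

definition colour_count :: "pole \<Rightarrow> nat list \<Rightarrow> nat" where
  "colour_count X p = card {cs. proper (open_edges X) cs \<and> drop (length (inner X)) cs = p}"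

definition starlike :: "nat \<Rightarrow> pole \<Rightarrow> bool" where
  "starlike n X \<longleftrightarrow> (\<forall>p. colour_count X p = (if p \<in> set star_patterns then n else 0))"

text \<open>The output patterns of the gadget with multiplicity, collected over all star patterns at
  its input. The far ends of the stubs start at \<open>order K + 5\<close>, beyond the outside ends
  of the gadget's own dangling edges.\<close>

definition transfer :: "pole \<Rightarrow> nat list list" where
  "transfer K = concat (map (\<lambda>p. map (drop (length (inner K)))
     (extensions (zip (stubs (order K + 5)) p) (open_edges K))) star_patterns)"

text \<open>Only column sums of the transfer matrix are prescribed: a starlike pole offers all input
  patterns equally often, so their individual contributions need not be known.\<close>

definition multiplies :: "nat \<Rightarrow> nat list list \<Rightarrow> bool" where
  "multiplies t ps \<longleftrightarrow> list_all (List.member star_patterns) ps \<and>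
     list_all (\<lambda>p. length (filter ((=) p) ps) = t) star_patterns"

lemma distinct_star_patterns: "distinct star_patterns"
  by code_simp

lemma star_pattern_colours: "p \<in> set star_patterns \<Longrightarrow> length p = 5 \<and> set p \<subseteq> {..<3}"
proof -
  have "list_all (\<lambda>p. length p = 5 \<and> list_all (\<lambda>c. c < 3) p) star_patterns" by code_simp
  then show "p \<in> set star_patterns \<Longrightarrow> length p = 5 \<and> set p \<subseteq> {..<3}"
    by (auto simp: list_all_iff)
qed

lemma multiplies_count:
  assumes "multiplies t ps"
  shows "length (filter ((=) p) ps) = (if p \<in> set star_patterns then t else 0)"
proof (cases "p \<in> set star_patterns")
  case False
  then have "filter ((=) p) ps = []"
    using assms by (auto simp: multiplies_def list_all_iff filter_empty_conv)
  then show ?thesis using False by simp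
qed (use assms in \<open>simp add: multiplies_def list_all_iff\<close>)

lemma colour_count_extensions:
  "colour_count X p = length (filter ((=) p) (map (drop (length (inner X))) (extensions [] (open_edges X))))"
proof -
  let ?f = "\<lambda>cs. drop (length (inner X)) cs = p"
  have "{cs. proper (open_edges X) cs \<and> ?f cs} = set (filter ?f (extensions [] (open_edges X)))"
    by (auto simp: in_extensions)
  moreover have "card (set (filter ?f xs)) = length (filter ?f xs)" if "distinct xs" for xs
    using that by (intro distinct_card) simp
  ultimately have "colour_count X p = length (filter ?f (extensions [] (open_edges X)))"
    unfolding colour_count_def by (simp only: distinct_extensions)
  then show ?thesis by (simp add: filter_map comp_def eq_commute[of p])
qed

lemma set_zip_open:
  assumes "length es = 5" "length p = 5"
  shows "set (zip es p) = (\<lambda>k. (es ! k, p ! k)) ` {..<5}"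
  using assms by (auto simp: set_zip)

text \<open>An attached edge can meet an edge of the pole only at the outer end of a dangling edge,
  which is vertex k of the attached part. The stub from k to the fresh vertex m + k has the same
  conflicts, so nothing but the boundary pattern matters.\<close>

lemma compatible_shift:
  assumes X: "wf_pole X" and F: "\<forall>(a, b)\<in>set F. a < m \<and> b < m"
    and cs: "length cs = length (open_edges X)"
  shows "compatible (zip (open_edges X) cs) (zip (shift (order X) F) ds) \<longleftrightarrow>
    compatible (zip (stubs m) (drop (length (inner X)) cs)) (zip F ds)"
proof -
  let ?n = "order X" and ?l = "length (inner X)"
  let ?g = "\<lambda>(e, d :: nat). (map_prod ((+) ?n) ((+) ?n) e, d)"
  have len: "length (terminals X) = 5" using X by (simp add: wf_pole_def)
  have lo: "length (drop ?l cs) = 5" using cs len by (simp add: open_edges_def)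
  have split: "zip (open_edges X) cs = zip (inner X) (take ?l cs) @
      zip (zip (terminals X) [?n..<?n + 5]) (drop ?l cs)"
    unfolding open_edges_def zip_append1 by simp
  have shift: "zip (shift ?n F) ds = map ?g (zip F ds)"
    by (simp add: shift_def zip_map1)
  have g: "set (map ?g B) = ?g ` set B" "fst (?g y) = map_prod ((+) ?n) ((+) ?n) (fst y)"
    "snd (?g y) = snd y" for B y by (auto simp: split_beta)
  have "\<not> meets e (map_prod ((+) ?n) ((+) ?n) f)" if "(e, c) \<in> set (zip (inner X) cs')" for e c f cs'
    using X set_zip_leftD[OF that] by (cases e; cases f) (fastforce simp: wf_pole_def)
  then have "compatible (zip (inner X) (take ?l cs)) (map ?g (zip F ds))"
    unfolding compatible_def conflict_free_def g by (force simp: split_beta)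
  moreover have "compatible (zip (zip (terminals X) [?n..<?n + 5]) (drop ?l cs)) (map ?g (zip F ds))
      \<longleftrightarrow> compatible (zip (stubs m) (drop ?l cs)) (zip F ds)"
  proof -
    have "conflict_free ((terminals X ! k, ?n + k), d) (?g y) \<longleftrightarrow> conflict_free ((m + k, k), d) y"
      if "k < 5" "y \<in> set (zip F ds)" for k d y
    proof -
      obtain a b d' where y: "y = ((a, b), d')" by (cases y; cases "fst y") auto
      have "terminals X ! k < ?n" using X that len by (auto simp: wf_pole_def subset_eq)
      moreover have "a < m" "b < m" using F that y by (auto dest: set_zip_leftD)
      ultimately show ?thesis using y by (auto simp: conflict_free_def)
    qed
    moreover have "set (zip (zip (terminals X) [?n..<?n + 5]) (drop ?l cs)) =
        (\<lambda>k. ((terminals X ! k, ?n + k), drop ?l cs ! k)) ` {..<5}"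
      using len lo by (subst set_zip_open) (auto intro!: image_cong simp del: nth_drop)
    moreover have "set (zip (stubs m) (drop ?l cs)) = (\<lambda>k. ((m + k, k), drop ?l cs ! k)) ` {..<5}"
      using lo by (subst set_zip_open) (auto simp: stubs_def intro!: image_cong simp del: nth_drop)
    ultimately show ?thesis unfolding compatible_def set_map by (simp del: nth_drop)
  qed
  ultimately show ?thesis unfolding split shift by simp
qed

lemma proper_attach:
  assumes "wf_pole X" "\<forall>(a, b)\<in>set F. a < m \<and> b < m" "length cs = length (open_edges X)"
  shows "proper (open_edges X @ shift (order X) F) (cs @ ds) \<longleftrightarrow> proper (open_edges X) cs \<and>
    ds \<in> set (extensions (zip (stubs m) (drop (length (inner X)) cs)) F)"
proof -
  have "proper (shift n F) ds \<longleftrightarrow> proper F ds" for n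
  proof -
    have "meets (map_prod ((+) n) ((+) n) e) (map_prod ((+) n) ((+) n) f) \<longleftrightarrow> meets e f" for e f
      by (cases e; cases f) auto
    then show ?thesis
      by (simp add: proper_def shift_def zip_map1 sorted_wrt_map split_beta conflict_free_def[abs_def])
  qed
  then show ?thesis
    using proper_append[OF assms(3)] compatible_shift[OF assms] by (auto simp: in_extensions)
qed

text \<open>Colourings of the glued pole are grouped by the boundary pattern of their restriction to
  \<open>X\<close>, which alone determines the number of extensions to \<open>K\<close>. Each star
  pattern has weight n and any other pattern weight 0, so what remains is n times a multiplicity in
  \<open>transfer K\<close>.\<close>

lemma starlike_glue:
  assumes X: "wf_pole X" "starlike n X" and K: "wf_pole K" "multiplies t (transfer K)"
  shows "starlike (n * t) (glue X K)"
  unfolding starlike_def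
proof
  fix r
  let ?lX = "length (inner X)" and ?lK = "length (inner K)"
  define L where "L = {cs. proper (open_edges X) cs}"
  define b where "b = (\<lambda>cs :: nat list. drop ?lX cs)"
  define B where "B = {p. set p \<subseteq> {..<3 :: nat} \<and> length p = 5}"
  define M where "M = (\<lambda>p. filter (\<lambda>ds. r = drop ?lK ds)
    (extensions (zip (stubs (order K + 5)) p) (open_edges K)))"
  have lenX: "length (open_edges X) = ?lX + 5" using X by (simp add: open_edges_def wf_pole_def)
  have finL: "finite L" unfolding L_def by (rule finite_proper)
  have finB: "finite B" unfolding B_def by (rule finite_lists_length_eq) simp
  have bB: "b ` L \<subseteq> B"
    using lenX by (auto simp: L_def B_def b_def proper_def dest: in_set_dropD)
  have DB: "set star_patterns \<subseteq> B" using star_pattern_colours by (auto simp: B_def)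
  have F: "\<forall>(a, c)\<in>set (open_edges K). a < order K + 5 \<and> c < order K + 5"
    using open_edges_bounds[OF K(1)] by fastforce
  have attach: "proper (open_edges X @ shift (order X) (open_edges K)) (cs @ ds) \<longleftrightarrow>
      cs \<in> L \<and> ds \<in> set (extensions (zip (stubs (order K + 5)) (b cs)) (open_edges K))"
    if "length cs = length (open_edges X)" for cs ds
    unfolding L_def b_def using proper_attach[OF X(1) F that] by simp
  have inner: "length (inner (glue X K)) = length (open_edges X) + ?lK"
    by (simp add: glue_def shift_def)
  have "{es. proper (open_edges (glue X K)) es \<and> drop (length (inner (glue X K))) es = r} =
      (\<lambda>(cs, ds). cs @ ds) ` (SIGMA cs:L. set (M (b cs)))" (is "?Z = ?I")
  proof
    show "?I \<subseteq> ?Z"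
    proof
      fix es assume "es \<in> ?I"
      then obtain cs ds where *: "es = cs @ ds" "cs \<in> L" "ds \<in> set (M (b cs))" by auto
      then have "length cs = length (open_edges X)" by (simp add: L_def proper_def)
      with * show "es \<in> ?Z" using attach[of cs ds] by (simp add: open_edges_glue inner M_def)
    qed
    show "?Z \<subseteq> ?I"
    proof
      fix es assume es: "es \<in> ?Z"
      define cs ds where "cs = take (length (open_edges X)) es" and "ds = drop (length (open_edges X)) es"
      have "es = cs @ ds" by (simp add: cs_def ds_def)
      moreover have "length cs = length (open_edges X)"
        using es by (simp add: cs_def proper_def open_edges_glue)
      ultimately have "cs \<in> L" "ds \<in> set (M (b cs))"
        using es attach[of cs ds] by (auto simp: open_edges_glue inner M_def)
      with \<open>es = cs @ ds\<close> show "es \<in> ?I" by (intro image_eqI[of _ _ "(cs, ds)"]) auto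
    qed
  qed
  then have "colour_count (glue X K) r = card ?I" unfolding colour_count_def by simp
  also have "\<dots> = card (SIGMA cs:L. set (M (b cs)))"
    by (intro card_image) (auto simp: inj_on_def L_def proper_def)
  also have "\<dots> = (\<Sum>cs\<in>L. card (set (M (b cs))))"
    using finL by simp
  also have "\<dots> = (\<Sum>cs\<in>L. length (M (b cs)))"
    by (intro sum.cong distinct_card refl) (simp add: M_def distinct_extensions)
  also have "\<dots> = (\<Sum>p\<in>B. \<Sum>cs\<in>{cs \<in> L. b cs = p}. length (M (b cs)))"
    by (rule sum.group[OF finL finB bB, symmetric])
  also have "\<dots> = (\<Sum>p\<in>B. colour_count X p * length (M p))"
    by (intro sum.cong) (auto simp: colour_count_def L_def b_def)
  also have "\<dots> = (\<Sum>p\<in>set star_patterns. n * length (M p))"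
    using X(2) DB finB by (intro sum.mono_neutral_cong_right) (auto simp: starlike_def)
  also have "\<dots> = n * (\<Sum>p\<leftarrow>star_patterns. length (M p))"
    by (simp add: sum_distrib_left sum_list_distinct_conv_sum_set distinct_star_patterns)
  also have "(\<Sum>p\<leftarrow>star_patterns. length (M p)) = length (filter ((=) r) (transfer K))"
    by (simp add: transfer_def M_def filter_concat length_concat comp_def filter_map)
  also have "\<dots> = (if r \<in> set star_patterns then t else 0)"
    using multiplies_count[OF K(2)] .
  finally show "colour_count (glue X K) r = (if r \<in> set star_patterns then n * t else 0)"
    by simp
qed

lemma starlike_not_closed_colourable:
  assumes X: "wf_pole X" "starlike n X"
  shows "\<not> proper (closed_edges X) es"
proof
  assume es: "proper (closed_edges X) es"
  let ?l = "length (open_edges X)"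
  define cs ds where "cs = take ?l es" and "ds = drop ?l es"
  have "es = cs @ ds" "length cs = ?l" using es by (simp_all add: cs_def ds_def proper_def closed_edges_def)
  moreover have "\<forall>(a, b)\<in>set pentagon. a < 5 \<and> b < 5" by (simp add: pentagon_def)
  ultimately have cs: "proper (open_edges X) cs"
    and ds: "ds \<in> set (extensions (zip (stubs 5) (drop (length (inner X)) cs)) pentagon)"
    using es proper_attach[OF X(1), of pentagon 5 cs ds] by (auto simp: closed_edges_def)
  have "colour_count X (drop (length (inner X)) cs) \<noteq> 0"
    unfolding colour_count_def using cs finite_proper[of "open_edges X"]
    by (auto simp: card_eq_0_iff intro: finite_subset[OF _ finite_proper])
  then have "drop (length (inner X)) cs \<in> set star_patterns"
    using X(2) by (auto simp: starlike_def split: if_splits)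
  moreover have "list_all (\<lambda>p. extensions (zip (stubs 5) p) pentagon = []) star_patterns"
    by code_simp
  ultimately show False using ds by (simp add: list_all_iff)
qed

section \<open>Closed poles as graphs\<close>

definition ends :: "nat \<times> nat \<Rightarrow> nat set" where
  "ends e = {fst e, snd e}"

definition pole_graph :: "pole \<Rightarrow> nat ugraph" where
  "pole_graph X = ({..<order X + 5}, ends ` set (closed_edges X))"

section \<open>Degrees, distinctness of edges, and well-formedness of glued poles\<close>

definition degree :: "(nat \<times> nat) list \<Rightarrow> nat \<Rightarrow> nat" where
  "degree es v = length (filter (\<lambda>(a, b). a = v \<or> b = v) es)"

lemma degree_simps [simp]:
  "degree [] v = 0"
  "degree (e # es) v = of_bool (fst e = v \<or> snd e = v) + degree es v"
  "degree (es @ fs) v = degree es v + degree fs v"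
  by (auto simp: degree_def split_beta)

lemma degree_eq_0:
  assumes "\<And>a b. (a, b) \<in> set es \<Longrightarrow> a \<noteq> v \<and> b \<noteq> v"
  shows "degree es v = 0"
  using assms by (auto simp: degree_def filter_empty_conv)

lemma degree_shift: "degree (shift n es) (n + v) = degree es v"
  by (induction es) auto

lemma degree_shift_less: "v < n \<Longrightarrow> degree (shift n es) v = 0"
  by (induction es) auto

lemma degree_stubs: "v < m \<Longrightarrow> degree (stubs m) v = of_bool (v < 5)"
  by (auto simp: stubs_def upt_five)

lemma degree_open_edges:
  assumes X: "wf_pole X"
  shows "degree (open_edges X) (order X + v) = of_bool (v < 5)"
proof -
  obtain t0 t1 t2 t3 t4 where t: "terminals X = [t0, t1, t2, t3, t4]"
    using X by (auto simp: wf_pole_def numeral_eq_Suc length_Suc_conv)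
  have "degree (inner X) (order X + v) = 0"
    using X by (intro degree_eq_0) (fastforce simp: wf_pole_def)
  moreover have "{t0, t1, t2, t3, t4} \<subseteq> {..<order X}" using X t by (simp add: wf_pole_def)
  ultimately show ?thesis by (auto simp: open_edges_def t upt_five)
qed

definition cubic_pole :: "pole \<Rightarrow> bool" where
  "cubic_pole X \<longleftrightarrow> (\<forall>v<order X. degree (open_edges X) v = 3)"

lemma degree_closed_edges:
  assumes X: "wf_pole X" "cubic_pole X" and v: "v < order X + 5"
  shows "degree (closed_edges X) v = 3"
proof (cases "v < order X")
  case True
  then show ?thesis using X by (simp add: closed_edges_def cubic_pole_def degree_shift_less)
next
  case False
  then obtain k where k: "v = order X + k" "k < 5" using v by (metis add_less_cancel_left le_Suc_ex not_less)
  then have "k \<in> {0, 1, 2, 3, 4}" by auto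
  then have "degree pentagon k = 2" by (auto simp: pentagon_def)
  then show ?thesis using k degree_open_edges[OF X(1), of k]
    by (simp add: closed_edges_def degree_shift)
qed

lemma distinct_shift [simp]: "distinct (shift n es) \<longleftrightarrow> distinct es"
proof -
  have "inj (map_prod ((+) n) ((+) n))" by (simp add: prod.inj_map)
  then show ?thesis unfolding shift_def distinct_map by (auto intro: inj_on_subset)
qed

lemma distinct_open_edges:
  assumes X: "wf_pole X"
  shows "distinct (open_edges X)"
proof -
  have "e \<notin> set (zip (terminals X) [order X..<order X + 5])" if "e \<in> set (inner X)" for e
  proof
    assume "e \<in> set (zip (terminals X) [order X..<order X + 5])"
    then have "snd e \<in> set [order X..<order X + 5]"
      by (metis prod.collapse set_zip_rightD)
    moreover have "snd e < order X" using X that by (auto simp: wf_pole_def)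
    ultimately show False by simp
  qed
  then show ?thesis using X unfolding open_edges_def
    by (auto simp: wf_pole_def distinct_zipI1)
qed

lemma set_shift_bound: "(a, b) \<in> set (shift n es) \<Longrightarrow> n \<le> a \<and> n \<le> b"
  by (auto simp: shift_def)

lemma distinct_closed_edges:
  assumes X: "wf_pole X"
  shows "distinct (closed_edges X)"
proof -
  have "distinct (shift (order X) pentagon)" by (simp add: pentagon_def)
  moreover have "set (open_edges X) \<inter> set (shift (order X) pentagon) = {}"
    using open_edges_bounds[OF X] set_shift_bound[of _ _ "order X" pentagon] by fastforce
  ultimately show ?thesis using distinct_open_edges[OF X] by (simp add: closed_edges_def)
qed

lemma wf_glue:
  assumes X: "wf_pole X" and K: "wf_pole K"
  shows "wf_pole (glue X K)"
proof -
  have inner: "inner (glue X K) = open_edges X @ shift (order X) (inner K)"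
    and ord: "order (glue X K) = order X + order K"
    and tms: "terminals (glue X K) = map ((+) (order X)) (terminals K)"
    by (simp_all add: glue_def)
  have "distinct (inner (glue X K))"
    using distinct_open_edges[OF X] K open_edges_bounds[OF X] set_shift_bound[of _ _ "order X" "inner K"]
    unfolding inner by (fastforce simp: wf_pole_def)
  moreover have "a < b \<and> b < order X + order K" if ab: "(a, b) \<in> set (inner (glue X K))" for a b
  proof (cases "(a, b) \<in> set (open_edges X)")
    case True
    then show ?thesis using open_edges_bounds[OF X True] K by (simp add: wf_pole_def)
  next
    case False
    then have "(a, b) \<in> set (shift (order X) (inner K))" using ab by (simp add: inner)
    then show ?thesis using K by (fastforce simp: shift_def wf_pole_def)
  qed
  moreover have "distinct (terminals (glue X K))" "length (terminals (glue X K)) = 5"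
    "set (terminals (glue X K)) \<subseteq> {..<order X + order K}"
    using K unfolding tms by (auto simp: wf_pole_def distinct_map)
  ultimately show ?thesis using X by (auto simp: wf_pole_def ord)
qed

lemma cubic_glue:
  assumes X: "wf_pole X" "cubic_pole X" and K: "wf_pole K"
    and deg: "\<forall>v<order K. degree (stubs (order K + 5) @ open_edges K) v = 3"
  shows "cubic_pole (glue X K)"
  unfolding cubic_pole_def
proof (intro allI impI)
  fix v assume v: "v < order (glue X K)"
  show "degree (open_edges (glue X K)) v = 3"
  proof (cases "v < order X")
    case True
    then show ?thesis using X by (simp add: open_edges_glue cubic_pole_def degree_shift_less)
  next
    case False
    then obtain w where w: "v = order X + w" by (metis le_Suc_ex not_less)
    then have "w < order K" using v by (simp add: glue_def)
    then have "degree (stubs (order K + 5)) w + degree (open_edges K) w = 3"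
      using deg by simp
    moreover have "degree (stubs (order K + 5)) w = degree (open_edges X) v"
      using degree_open_edges[OF X(1), of w] degree_stubs[of w "order K + 5"] \<open>w < order K\<close> w
      by simp
    moreover have "degree (open_edges (glue X K)) v =
        degree (open_edges X) v + degree (open_edges K) w"
      by (simp add: open_edges_glue w degree_shift)
    ultimately show ?thesis by simp
  qed
qed

lemma card_ends_filter:
  assumes "distinct (map ends es)"
  shows "card {e \<in> ends ` set es. P e} = length (filter (\<lambda>e. P (ends e)) es)"
proof -
  have "{e \<in> ends ` set es. P e} = set (map ends (filter (\<lambda>e. P (ends e)) es))" by auto
  moreover have "distinct (map ends (filter (\<lambda>e. P (ends e)) es))"
    using assms by (simp add: distinct_map_filter)
  ultimately show ?thesis by (metis distinct_card length_map)
qed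

lemma distinct_ends:
  assumes X: "wf_pole X"
  shows "distinct (map ends (closed_edges X))"
proof -
  have "inj_on ends (set (closed_edges X))"
  proof (rule inj_onI)
    fix e f assume "e \<in> set (closed_edges X)" "f \<in> set (closed_edges X)" "ends e = ends f"
    moreover from this have "fst e < snd e" "fst f < snd f"
      using closed_edges_bounds(1)[OF X, of "fst e" "snd e"]
        closed_edges_bounds(1)[OF X, of "fst f" "snd f"] by simp_all
    ultimately show "e = f" by (auto simp: ends_def doubleton_eq_iff prod_eq_iff)
  qed
  then show ?thesis using distinct_closed_edges[OF X] by (simp add: distinct_map)
qed

lemma well_cut_cubic_pole_graph:
  assumes X: "wf_pole X" "cubic_pole X" and cut: "well_cut (order X + 5) (closed_edges X)"
  shows "well_cut_cubic_graph {..<order X + 5} (ends ` set (closed_edges X))"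
proof
  let ?V = "{..<order X + 5}" and ?E = "ends ` set (closed_edges X)"
  show "finite ?V" by simp
  show "e \<subseteq> ?V \<and> card e = 2" if e: "e \<in> ?E" for e
  proof -
    obtain a b where ab: "(a, b) \<in> set (closed_edges X)" "e = {a, b}"
      using e by (auto simp: ends_def)
    then show ?thesis using closed_edges_bounds[OF X(1) ab(1)] by auto
  qed
  show "card {e \<in> ?E. v \<in> e} = 3" if "v \<in> ?V" for v
  proof -
    have "degree (closed_edges X) v = 3" using degree_closed_edges[OF X] that by simp
    moreover have "degree (closed_edges X) v = length (filter (\<lambda>e. v \<in> ends e) (closed_edges X))"
      unfolding degree_def by (intro arg_cong[where f = length] filter_cong) (auto simp: ends_def)
    ultimately show ?thesis by (simp only: card_ends_filter[OF distinct_ends[OF X(1)]])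
  qed
  show "min (cut_bound (card S)) (cut_bound (card (?V - S))) \<le> card (edge_boundary ?E S)"
    if S: "S \<subseteq> ?V" for S
  proof -
    have "card (edge_boundary ?E S) = cut_size (closed_edges X) S"
      unfolding edge_boundary_def card_ends_filter[OF distinct_ends[OF X(1)]] cut_size_def
      by (intro arg_cong[where f = length] filter_cong) (auto simp: ends_def)
    then show ?thesis using cut S by (simp add: well_cut_def)
  qed
  show "7 \<le> card ?V" using X by (simp add: wf_pole_def)
qed

section \<open>From colour lists to colourings and decompositions of graphs\<close>

lemma proper_iff_nth:
  "proper es cs \<longleftrightarrow> length cs = length es \<and> (\<forall>i<length es. cs ! i < 3) \<and>
     (\<forall>i<length es. \<forall>j<length es. i \<noteq> j \<and> meets (es ! i) (es ! j) \<longrightarrow> cs ! i \<noteq> cs ! j)"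
proof -
  have "set cs \<subseteq> {..<3} \<longleftrightarrow> (\<forall>i<length cs. cs ! i < 3)"
    by (auto simp: set_conv_nth)
  moreover have "sorted_wrt conflict_free (zip es cs) \<longleftrightarrow>
      (\<forall>i<length es. \<forall>j<length es. i \<noteq> j \<and> meets (es ! i) (es ! j) \<longrightarrow> cs ! i \<noteq> cs ! j)"
    if "length cs = length es"
  proof -
    have "sorted_wrt conflict_free (zip es cs) \<longleftrightarrow>
        (\<forall>i j. i < j \<longrightarrow> j < length es \<longrightarrow> meets (es ! i) (es ! j) \<longrightarrow> cs ! i \<noteq> cs ! j)"
      using that by (simp add: sorted_wrt_iff_nth_less conflict_free_def)
    also have "\<dots> \<longleftrightarrow> (\<forall>i<length es. \<forall>j<length es. i \<noteq> j \<and> meets (es ! i) (es ! j) \<longrightarrow> cs ! i \<noteq> cs ! j)"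
      (is "?A \<longleftrightarrow> ?B")
    proof
      assume A: ?A
      show ?B
      proof (intro allI impI, elim conjE)
        fix i j assume "i < length es" "j < length es" "i \<noteq> j" "meets (es ! i) (es ! j)"
        then show "cs ! i \<noteq> cs ! j"
          using A[rule_format, of i j] A[rule_format, of j i] meets_commute[of "es ! i"]
          by (cases "i < j") auto
      qed
    next
      assume ?B
      then show ?A by auto
    qed
    finally show ?thesis .
  qed
  ultimately show ?thesis by (auto simp: proper_def)
qed

lemma ends_meet: "ends e \<inter> ends f \<noteq> {} \<longleftrightarrow> meets e f"
  by (cases e; cases f) (auto simp: ends_def)

lemma starlike_not_colourable:
  assumes X: "wf_pole X" "starlike n X"
  shows "\<not> three_edge_colourable (pole_graph X)"
proof
  let ?es = "closed_edges X"
  assume "three_edge_colourable (pole_graph X)"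
  then obtain c where c: "c \<in> three_edge_colourings (multigraph_of (pole_graph X))"
    by (auto simp: three_edge_colourable_def)
  have ends: "ends (?es ! i) \<in> ends ` set ?es" if "i < length ?es" for i using that by simp
  have "\<forall>e\<in>ends ` set ?es. \<forall>f\<in>ends ` set ?es. e \<noteq> f \<and> e \<inter> f \<noteq> {} \<longrightarrow> c e \<noteq> c f"
    using c unfolding three_edge_colourings_def multigraph_of_def pole_graph_def adjacent_edges_def
    by simp
  moreover have "c e < 3" if "e \<in> ends ` set ?es" for e
    using c that by (auto simp: three_edge_colourings_def multigraph_of_def pole_graph_def)
  moreover have "ends (?es ! i) \<noteq> ends (?es ! j)" if "i < length ?es" "j < length ?es" "i \<noteq> j" for i j
    using distinct_ends[OF X(1)] that by (metis length_map nth_eq_iff_index_eq nth_map)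
  ultimately have "proper ?es (map (\<lambda>e. c (ends e)) ?es)"
    using ends by (auto simp: proper_iff_nth ends_meet[symmetric])
  then show False using starlike_not_closed_colourable[OF X] by blast
qed

text \<open>The colours of three pairwise adjacent edges name the classes of a decomposition, so
  decompositions correspond to colourings normalised on these edges.\<close>
lemma card_three_edge_decompositions:
  assumes nm: "distinct nm" "set nm = medges M" "list_all2 (\<lambda>x e. mends M x = ends e) nm es"
    and abc: "a < length es" "b < length es" "c < length es" "a \<noteq> b" "a \<noteq> c" "b \<noteq> c"
    and meet: "meets (es ! a) (es ! b)" "meets (es ! a) (es ! c)" "meets (es ! b) (es ! c)"
  shows "card (three_edge_decompositions M) =
    card {cs. proper es cs \<and> cs ! a = 0 \<and> cs ! b = 1 \<and> cs ! c = 2}"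
proof -
  let ?l = "length es"
  let ?S = "{cs. proper es cs \<and> cs ! a = 0 \<and> cs ! b = 1 \<and> cs ! c = 2}"
  have len: "length nm = ?l" using nm(3) by (rule list_all2_lengthD)
  have nm_eq: "nm ! i = nm ! j \<longleftrightarrow> i = j" if "i < ?l" "j < ?l" for i j
    using nm(1) that len by (simp add: nth_eq_iff_index_eq)
  have nm_mem: "x \<in> medges M \<longleftrightarrow> (\<exists>i<?l. x = nm ! i)" for x
    unfolding nm(2)[symmetric] len[symmetric] by (auto simp: in_set_conv_nth)
  have adj: "adjacent_edges M (nm ! i) (nm ! j) \<longleftrightarrow> i \<noteq> j \<and> meets (es ! i) (es ! j)"
    if "i < ?l" "j < ?l" for i j
    using nm(3) that len nm_eq[OF that]
    by (simp add: adjacent_edges_def list_all2_conv_all_nth ends_meet)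
  define cls where "cls = (\<lambda>cs (k :: nat). {nm ! i | i. i < ?l \<and> cs ! i = k})"
  have cls_nth: "nm ! i \<in> cls cs k \<longleftrightarrow> cs ! i = k" if "i < ?l" for i cs k
    using that nm_eq by (auto simp: cls_def)
  have cls_eqI: "cls cs k = D"
    if D: "D \<subseteq> medges M" "\<And>i. i < ?l \<Longrightarrow> cs ! i = k \<longleftrightarrow> nm ! i \<in> D" for cs k D
  proof
    show "cls cs k \<subseteq> D" using D(2) by (auto simp: cls_def)
    show "D \<subseteq> cls cs k"
    proof
      fix x assume "x \<in> D"
      moreover from this obtain i where "i < ?l" "x = nm ! i" using D(1) nm_mem by blast
      ultimately show "x \<in> cls cs k" using D(2) cls_nth by blast
    qed
  qed
  have three: "{..<3} = {0, 1, 2 :: nat}" by auto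
  have rep: "cls cs 0 \<noteq> {}" "cls cs 1 \<noteq> {}" "cls cs 2 \<noteq> {}" if "cs \<in> ?S" for cs
    using that abc cls_nth[of a cs 0] cls_nth[of b cs 1] cls_nth[of c cs 2] by auto
  have disj: "cls cs k \<inter> cls cs k' = {}" if "k \<noteq> k'" for cs k k'
    using that nm_eq by (auto simp: cls_def)
  have "bij_betw (\<lambda>cs. cls cs ` {..<3}) ?S (three_edge_decompositions M)"
    unfolding bij_betw_def
  proof
    show "inj_on (\<lambda>cs. cls cs ` {..<3}) ?S"
    proof (rule inj_onI)
      fix cs cs' assume cs: "cs \<in> ?S" and cs': "cs' \<in> ?S" and eq: "cls cs ` {..<3} = cls cs' ` {..<3}"
      \<comment> \<open>The class of colour k is recognised as the one containing the reference edge
        \<open>nm ! i\<close>, which has colour k in both colourings.\<close>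
      have same: "cls cs k = cls cs' k" if i: "i < ?l" "cs ! i = k" "cs' ! i = k" "k < 3" for i k
      proof -
        have "cls cs k \<in> cls cs' ` {..<3}" using eq i by blast
        then obtain k' where k': "cls cs k = cls cs' k'" by blast
        have "nm ! i \<in> cls cs' k'" using cls_nth[OF i(1)] i k' by blast
        then have "k' = k" using cls_nth[OF i(1)] i by simp
        with k' show ?thesis by simp
      qed
      have all: "cls cs k = cls cs' k" if k: "k < 3" for k
      proof -
        consider "k = 0" | "k = 1" | "k = 2" using k by linarith
        then show ?thesis
          using same[of a 0] same[of b 1] same[of c 2] cs cs' abc by cases auto
      qed
      have "cs ! i = cs' ! i" if "i < ?l" for i
      proof -
        have "cs ! i < 3" using cs that by (simp add: proper_iff_nth)
        then show ?thesis using cls_nth[OF that] all by metis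
      qed
      then show "cs = cs'" using cs cs' by (intro nth_equalityI) (auto simp: proper_def)
    qed
    show "(\<lambda>cs. cls cs ` {..<3}) ` ?S = three_edge_decompositions M"
    proof
      show "(\<lambda>cs. cls cs ` {..<3}) ` ?S \<subseteq> three_edge_decompositions M"
      proof
        fix P assume "P \<in> (\<lambda>cs. cls cs ` {..<3}) ` ?S"
        then obtain cs where cs: "cs \<in> ?S" and P: "P = cls cs ` {..<3}" by blast
        have P3: "P = {cls cs 0, cls cs 1, cls cs 2}" unfolding P three by simp
        have ne: "cls cs 0 \<noteq> cls cs 1" "cls cs 0 \<noteq> cls cs 2" "cls cs 1 \<noteq> cls cs 2"
          using rep[OF cs] disj[of 0 1 cs] disj[of 0 2 cs] disj[of 1 2 cs] by auto
        have "partition_on (medges M) P"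
        proof (rule partition_onI)
          show "\<Union> P = medges M"
          proof
            show "\<Union> P \<subseteq> medges M" by (auto simp: P cls_def nm_mem)
            show "medges M \<subseteq> \<Union> P"
            proof
              fix x assume "x \<in> medges M"
              then obtain i where i: "i < ?l" "x = nm ! i" using nm_mem by blast
              then have "x \<in> cls cs (cs ! i)" "cs ! i < 3"
                using cls_nth cs by (simp_all add: proper_iff_nth)
              then show "x \<in> \<Union> P" unfolding P by blast
            qed
          qed
          show "disjnt p q" if pq: "p \<in> P" "q \<in> P" "p \<noteq> q" for p q
          proof -
            obtain k k' where "p = cls cs k" "q = cls cs k'" using pq by (auto simp: P)
            then show ?thesis using pq disj[of k k' cs] by (auto simp: disjnt_def)
          qed
          show "{} \<notin> P" using rep[OF cs] by (auto simp: P3)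
        qed
        moreover have "card P = 3" using ne by (simp add: P3)
        moreover have "\<not> adjacent_edges M e f" if ef: "C \<in> P" "e \<in> C" "f \<in> C" for C e f
        proof -
          obtain k where "C = cls cs k" using ef by (auto simp: P)
          then obtain i j where ij: "i < ?l" "j < ?l" "e = nm ! i" "f = nm ! j" "cs ! i = cs ! j"
            using ef by (auto simp: cls_def)
          have "cs ! i \<noteq> cs ! j" if "i \<noteq> j" "meets (es ! i) (es ! j)"
            using cs ij(1,2) that by (simp add: proper_iff_nth)
          then show ?thesis using ij adj[of i j] by auto
        qed
        ultimately show "P \<in> three_edge_decompositions M"
          by (simp add: three_edge_decompositions_def)
      qed
      show "three_edge_decompositions M \<subseteq> (\<lambda>cs. cls cs ` {..<3}) ` ?S"
      proof
        fix P assume "P \<in> three_edge_decompositions M"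
        then have part: "partition_on (medges M) P" and card: "card P = 3"
          and proper: "\<And>C e f. C \<in> P \<Longrightarrow> e \<in> C \<Longrightarrow> f \<in> C \<Longrightarrow> \<not> adjacent_edges M e f"
          by (auto simp: three_edge_decompositions_def)
        have "\<exists>C\<in>P. nm ! i \<in> C" if "i < ?l" for i
          using part that nm_mem by (auto simp: partition_on_def)
        then obtain A B C where A: "A \<in> P" "nm ! a \<in> A" and B: "B \<in> P" "nm ! b \<in> B"
          and C: "C \<in> P" "nm ! c \<in> C" using abc by metis
        \<comment> \<open>Pairwise adjacent edges lie in different classes, so the classes of the
          three reference edges are all of the partition and can be named 0, 1, 2.\<close>
        have "A \<noteq> B" "A \<noteq> C" "B \<noteq> C"
          using A B C proper adj abc meet by metis+
        then have "card {A, B, C} = 3" by simp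
        then have P: "P = {A, B, C}"
          using A B C card by (metis card.infinite card_subset_eq empty_subsetI insert_subset zero_neq_numeral)
        have dj: "p \<inter> q = {}" if "p \<in> P" "q \<in> P" "p \<noteq> q" for p q
          using part that by (auto simp: partition_on_def disjoint_def)
        have un: "A \<union> B \<union> C = medges M" using part by (auto simp: partition_on_def P)
        define cs where "cs = map (\<lambda>x. if x \<in> A then 0 else if x \<in> B then 1 else 2 :: nat) nm"
        have csn: "cs ! i = (if nm ! i \<in> A then 0 else if nm ! i \<in> B then 1 else 2)" if "i < ?l" for i
          using that len by (simp add: cs_def)
        have AB: "A \<inter> B = {}" "A \<inter> C = {}" "B \<inter> C = {}"
          using dj[of A B] dj[of A C] dj[of B C] \<open>A \<noteq> B\<close> \<open>A \<noteq> C\<close> \<open>B \<noteq> C\<close> A B C by auto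
        have mem: "nm ! i \<in> A \<or> nm ! i \<in> B \<or> nm ! i \<in> C" if "i < ?l" for i
          using un nm_mem that by blast
        have "cs ! i = 0 \<longleftrightarrow> nm ! i \<in> A" "cs ! i = 1 \<longleftrightarrow> nm ! i \<in> B" "cs ! i = 2 \<longleftrightarrow> nm ! i \<in> C"
          if "i < ?l" for i
          using csn[OF that] mem[OF that] AB by (auto split: if_splits)
        then have "cls cs 0 = A" "cls cs 1 = B" "cls cs 2 = C"
          using un by (intro cls_eqI; blast)+
        then have "P = cls cs ` {..<3}" unfolding three by (simp add: P)
        moreover have "cs ! i \<noteq> cs ! j"
          if "i < ?l" "j < ?l" "i \<noteq> j" "meets (es ! i) (es ! j)" for i j
          using adj[OF that(1,2)] that proper[OF A(1)] proper[OF B(1)] proper[OF C(1)]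
            mem[of i] mem[of j] by (auto simp: csn)
        then have "proper es cs" using len csn by (auto simp: proper_iff_nth cs_def)
        moreover have "cs ! a = 0" "cs ! b = 1" "cs ! c = 2"
          using csn[OF abc(1)] csn[OF abc(2)] csn[OF abc(3)] A B C AB by auto
        ultimately show "P \<in> (\<lambda>cs. cls cs ` {..<3}) ` ?S" by blast
      qed
    qed
  qed
  then show ?thesis by (rule bij_betw_same_card[symmetric])
qed

lemma list_all2_map_self: "list_all2 P (map f xs) xs \<longleftrightarrow> (\<forall>x\<in>set xs. P (f x) x)"
  by (induction xs) auto

text \<open>What is left of dangling edges and closing pentagon when the edge from n to n + 1 is
  subtracted: the ends at n and n + 1 move on to the next pentagon vertices n + 4 and n + 2, and the
  path n + 2, n + 3, n + 4 survives. The first five entries keep the order of the dangling edges, so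
  boundary patterns can be compared position by position.\<close>

definition subtracted_tail :: "nat list \<Rightarrow> nat \<Rightarrow> (nat \<times> nat) list" where
  "subtracted_tail ts n = zip ts [n + 4, n + 2, n + 2, n + 3, n + 4] @ [(n + 2, n + 3), (n + 3, n + 4)]"

text \<open>An edge whose second end is outside the pole meets inner edges only at its first end, so
  it may be replaced by a loop there. This makes dangling edges with different outer ends
  interchangeable as far as inner edges are concerned.\<close>

lemma compatible_low:
  assumes es: "\<forall>e\<in>set es. fst e < n \<and> snd e < n" and B: "\<forall>x\<in>set B. n \<le> snd (fst x)"
  shows "compatible (zip es cs) B \<longleftrightarrow>
    compatible (zip es cs) (map (\<lambda>(f, d). ((fst f, fst f), d)) (filter (\<lambda>(f, d). fst f < n) B))"
proof -
  have "meets e f \<longleftrightarrow> fst f < n \<and> meets e (fst f, fst f)"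
    if "(e, c) \<in> set (zip es cs)" "(f, d) \<in> set B" for e c f d
    using es B set_zip_leftD[OF that(1)] that(2) by (cases e; cases f) fastforce
  then show ?thesis by (fastforce simp: compatible_def conflict_free_def)
qed

text \<open>Normalise the colours at the middle vertex of the path left over from the pentagon to
  0, 1, 2. Four boundary patterns then extend over the path, three of which are star patterns.\<close>
lemma card_subtracted_colourings:
  assumes X: "wf_pole X" "starlike n X"
  shows "card {cs. proper (inner X @ subtracted_tail (terminals X) (order X)) cs \<and>
      cs ! (length (inner X) + 5) = 0 \<and> cs ! (length (inner X) + 3) = 1 \<and>
      cs ! (length (inner X) + 6) = 2} = 3 * n"
proof -
  let ?l = "length (inner X)" and ?n = "order X"
  \<comment> \<open>At n + 3 the path edges have colours 0 and 2 and dangling edge 3 has colour 1.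
    Hence edges 1 and 2, meeting at n + 2, carry 1 and 2, and edges 0 and 4, meeting at n + 4, carry
    0 and 1, each in either order. Only \<open>[0, 2, 1, 1, 1]\<close> has its single colours in
    adjacent positions.\<close>
  define T :: "nat list set" where
    "T = {[0, 1, 2, 1, 1], [0, 2, 1, 1, 1], [1, 1, 2, 1, 0], [1, 2, 1, 1, 0]}"
  obtain t0 t1 t2 t3 t4 where t: "terminals X = [t0, t1, t2, t3, t4]"
    using X by (auto simp: wf_pole_def numeral_eq_Suc length_Suc_conv)
  have tl: "t0 < ?n" "t1 < ?n" "t2 < ?n" "t3 < ?n" "t4 < ?n" and td: "distinct [t0, t1, t2, t3, t4]"
    using X t by (simp_all add: wf_pole_def)
  have low: "\<forall>e\<in>set (inner X). fst e < ?n \<and> snd e < ?n"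
    using X by (fastforce simp: wf_pole_def)
  have key: "proper (inner X @ subtracted_tail (terminals X) ?n) (c @ [p0, p1, p2, p3, p4, x, y]) \<and>
      x = 0 \<and> p3 = 1 \<and> y = 2 \<longleftrightarrow>
    proper (open_edges X) (c @ [p0, p1, p2, p3, p4]) \<and> [p0, p1, p2, p3, p4] \<in> T \<and> x = 0 \<and> y = 2"
    if "length c = ?l" for c p0 p1 p2 p3 p4 x y
  proof -
    have tne: "t \<noteq> ?n + k" "?n + k \<noteq> t" "t \<noteq> ?n" "?n \<noteq> t" "t \<noteq> Suc ?n" "Suc ?n \<noteq> t"
      "t \<noteq> Suc (Suc ?n)" "Suc (Suc ?n) \<noteq> t" if "t < ?n" for t k
      using that by auto
    have tail: "proper (subtracted_tail (terminals X) ?n) [p0, p1, p2, p3, p4, x, y] \<longleftrightarrow>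
        p0 < 3 \<and> p1 < 3 \<and> p2 < 3 \<and> p3 < 3 \<and> p4 < 3 \<and> x < 3 \<and> y < 3 \<and> p0 \<noteq> p4 \<and> p1 \<noteq> p2 \<and>
        p1 \<noteq> x \<and> p2 \<noteq> x \<and> p3 \<noteq> x \<and> p3 \<noteq> y \<and> p0 \<noteq> y \<and> p4 \<noteq> y \<and> x \<noteq> y"
      using td by (simp add: proper_def subtracted_tail_def t conflict_free_def tne tl) argo
    have open_tail: "proper (zip (terminals X) [?n..<?n + 5]) [p0, p1, p2, p3, p4] \<longleftrightarrow>
        p0 < 3 \<and> p1 < 3 \<and> p2 < 3 \<and> p3 < 3 \<and> p4 < 3"
      using td by (simp add: proper_def t upt_five conflict_free_def tne tl)
    have pattern: "[p0, p1, p2, p3, p4] \<in> T \<longleftrightarrow> p3 = 1 \<and>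
        (p0 = 0 \<and> p4 = 1 \<or> p0 = 1 \<and> p4 = 0) \<and> (p1 = 1 \<and> p2 = 2 \<or> p1 = 2 \<and> p2 = 1)"
      by (auto simp: T_def)
    have "proper (subtracted_tail (terminals X) ?n) [p0, p1, p2, p3, p4, x, y] \<and>
          x = 0 \<and> p3 = 1 \<and> y = 2 \<longleftrightarrow>
        proper (zip (terminals X) [?n..<?n + 5]) [p0, p1, p2, p3, p4] \<and>
          [p0, p1, p2, p3, p4] \<in> T \<and> x = 0 \<and> y = 2"
    proof (cases "x = 0 \<and> p3 = 1 \<and> y = 2")
      case True
      have "p0 < 3 \<and> p4 < 3 \<and> p0 \<noteq> p4 \<and> p0 \<noteq> 2 \<and> p4 \<noteq> 2 \<longleftrightarrow>
          p0 = 0 \<and> p4 = 1 \<or> p0 = 1 \<and> p4 = 0"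
        "p1 < 3 \<and> p2 < 3 \<and> p1 \<noteq> p2 \<and> p1 \<noteq> 0 \<and> p2 \<noteq> 0 \<longleftrightarrow>
          p1 = 1 \<and> p2 = 2 \<or> p1 = 2 \<and> p2 = 1"
        by auto
      then have "p0 < 3 \<and> p1 < 3 \<and> p2 < 3 \<and> p4 < 3 \<and> p0 \<noteq> p4 \<and> p1 \<noteq> p2 \<and>
          p1 \<noteq> 0 \<and> p2 \<noteq> 0 \<and> p0 \<noteq> 2 \<and> p4 \<noteq> 2 \<longleftrightarrow>
          (p0 < 3 \<and> p1 < 3 \<and> p2 < 3 \<and> p4 < 3) \<and>
          (p0 = 0 \<and> p4 = 1 \<or> p0 = 1 \<and> p4 = 0) \<and> (p1 = 1 \<and> p2 = 2 \<or> p1 = 2 \<and> p2 = 1)"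
        by argo
      with True show ?thesis unfolding tail open_tail pattern by simp
    next
      case False
      then show ?thesis unfolding pattern by blast
    qed
    moreover have "compatible (zip (inner X) c)
          (zip (subtracted_tail (terminals X) ?n) [p0, p1, p2, p3, p4, x, y]) \<longleftrightarrow>
        compatible (zip (inner X) c) (zip (zip (terminals X) [?n..<?n + 5]) [p0, p1, p2, p3, p4])"
      using compatible_low[OF low, of "zip (subtracted_tail (terminals X) ?n) [p0, p1, p2, p3, p4, x, y]" c]
        compatible_low[OF low, of "zip (zip (terminals X) [?n..<?n + 5]) [p0, p1, p2, p3, p4]" c] tl
      by (simp add: subtracted_tail_def t upt_five)
    ultimately show ?thesis
      unfolding open_edges_def by (auto simp: proper_append that)
  qed
  have "{cs. proper (inner X @ subtracted_tail (terminals X) ?n) cs \<and>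
      cs ! (?l + 5) = 0 \<and> cs ! (?l + 3) = 1 \<and> cs ! (?l + 6) = 2} =
    (\<lambda>cs. cs @ [0, 2]) ` {cs. proper (open_edges X) cs \<and> drop ?l cs \<in> T}" (is "?L = ?R")
  proof
    show "?L \<subseteq> ?R"
    proof
      fix cs assume cs: "cs \<in> ?L"
      then have "length cs = ?l + 7"
        by (simp add: proper_def subtracted_tail_def t)
      then have "length (drop ?l cs) = 7" by simp
      then obtain p0 p1 p2 p3 p4 x y where d: "drop ?l cs = [p0, p1, p2, p3, p4, x, y]"
        by (auto simp: numeral_eq_Suc length_Suc_conv simp del: length_drop)
      define c where "c = take ?l cs"
      have c: "cs = c @ [p0, p1, p2, p3, p4, x, y]" "length c = ?l"
        using \<open>length cs = ?l + 7\<close> unfolding c_def d[symmetric] by simp_all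
      have "cs = (c @ [p0, p1, p2, p3, p4]) @ [x, y]" using c by simp
      moreover have "x = 0 \<and> p3 = 1 \<and> y = 2"
        using cs c by (simp add: nth_append)
      ultimately show "cs \<in> ?R"
        using cs key[OF c(2), of p0 p1 p2 p3 p4 x y] c
        by (intro image_eqI[of _ _ "c @ [p0, p1, p2, p3, p4]"]) auto
    qed
    show "?R \<subseteq> ?L"
    proof
      fix cs assume "cs \<in> ?R"
      then obtain ds where ds: "cs = ds @ [0, 2]" "proper (open_edges X) ds" "drop ?l ds \<in> T" by blast
      then have "length (drop ?l ds) = 5" by (auto simp: T_def simp del: length_drop)
      then obtain p0 p1 p2 p3 p4 where d: "drop ?l ds = [p0, p1, p2, p3, p4]"
        by (auto simp: numeral_eq_Suc length_Suc_conv simp del: length_drop)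
      define c where "c = take ?l ds"
      have "length ds = ?l + 5" using ds(2) by (simp add: proper_def open_edges_def t)
      then have c: "ds = c @ [p0, p1, p2, p3, p4]" "length c = ?l"
        unfolding c_def d[symmetric] by simp_all
      show "cs \<in> ?L"
        using ds key[OF c(2), of p0 p1 p2 p3 p4 0 2] c d by (auto simp: nth_append)
    qed
  qed
  then have "card ?L = card {cs. proper (open_edges X) cs \<and> drop ?l cs \<in> T}"
    by (simp add: card_image inj_on_def)
  also have "\<dots> = card (\<Union>p\<in>T. {cs. proper (open_edges X) cs \<and> drop ?l cs = p})"
    by (intro arg_cong[where f = card]) auto
  also have "\<dots> = (\<Sum>p\<in>T. colour_count X p)"
    unfolding colour_count_def T_def
    by (intro card_UN_disjoint) (auto intro: finite_subset[OF _ finite_proper])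
  also have "\<dots> = (\<Sum>p\<in>T. if List.member star_patterns p then n else 0)"
    using X(2) by (simp add: starlike_def)
  also have "\<dots> = 3 * n"
  proof -
    have "List.member star_patterns [0, 1, 2, 1, 1] \<and> \<not> List.member star_patterns [0, 2, 1, 1, 1] \<and>
      List.member star_patterns [1, 1, 2, 1, 0] \<and> List.member star_patterns [1, 2, 1, 1, 0]"
      by code_simp
    then show ?thesis by (simp add: T_def)
  qed
  finally show ?thesis .
qed

lemma psi_pole_graph:
  assumes X: "wf_pole X" "starlike n X"
  shows "psi (pole_graph X) {order X, order X + 1} = n"
proof -
  let ?n = "order X" and ?l = "length (inner X)"
  obtain t0 t1 t2 t3 t4 where t: "terminals X = [t0, t1, t2, t3, t4]"
    using X by (auto simp: wf_pole_def numeral_eq_Suc length_Suc_conv)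
  have tl: "t0 < ?n" "t1 < ?n" "t2 < ?n" "t3 < ?n" "t4 < ?n" and td: "distinct [t0, t1, t2, t3, t4]"
    using X t by (simp_all add: wf_pole_def)
  define I where "I = ends ` set (inner X)"
  have I: "e \<subseteq> {..<?n}" if "e \<in> I" for e
    using that X by (fastforce simp: I_def ends_def wf_pole_def)
  then have notI: "\<not> v \<in> e" if "e \<in> I" "?n \<le> v" for e v using that by fastforce
  have E: "uedges (pole_graph X) = I \<union>
      {{t0, ?n}, {t1, ?n + 1}, {t2, ?n + 2}, {t3, ?n + 3}, {t4, ?n + 4},
       {?n, ?n + 1}, {?n + 1, ?n + 2}, {?n + 2, ?n + 3}, {?n + 3, ?n + 4}, {?n, ?n + 4}}"
    by (auto simp: pole_graph_def closed_edges_def open_edges_def t upt_five pentagon_def ends_def I_def)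
  define M where "M = edge_subtraction (pole_graph X) {?n, ?n + 1}"
  define es where "es = inner X @ subtracted_tail (terminals X) ?n"
  \<comment> \<open>The order is that of \<open>es\<close>: the two new edges \<open>Inr\<close>
    take the places of dangling edges 0 and 1.\<close>
  define nm :: "(nat set + nat) list" where
    "nm = map (Inl \<circ> ends) (inner X) @ [Inr ?n, Inr (?n + 1), Inl {t2, ?n + 2}, Inl {t3, ?n + 3},
       Inl {t4, ?n + 4}, Inl {?n + 2, ?n + 3}, Inl {?n + 3, ?n + 4}]"
  have end0: "{y. {?n, y} \<in> uedges (pole_graph X) \<and> {?n, y} \<noteq> {?n, ?n + 1}} = {t0, ?n + 4}"
    unfolding E using notI[of "{?n, _}" ?n] tl by (auto simp: doubleton_eq_iff)
  have end1: "{y. {?n + 1, y} \<in> uedges (pole_graph X) \<and> {?n + 1, y} \<noteq> {?n, ?n + 1}} = {t1, ?n + 2}"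
    unfolding E using notI[of "{?n + 1, _}" "?n + 1"] tl by (auto simp: doubleton_eq_iff)
  have mends: "mends M (Inl f) = f" "mends M (Inr ?n) = {t0, ?n + 4}"
    "mends M (Inr (?n + 1)) = {t1, ?n + 2}" for f
    unfolding M_def edge_subtraction_def multigraph.select_convs sum.case end0 end1 by simp_all
  have avoid: "{f \<in> uedges (pole_graph X). f \<inter> {?n, ?n + 1} = {}} = I \<union>
      {{t2, ?n + 2}, {t3, ?n + 3}, {t4, ?n + 4}, {?n + 2, ?n + 3}, {?n + 3, ?n + 4}}"
    unfolding E using notI tl by auto
  have "set nm = Inl ` I \<union> {Inr ?n, Inr (?n + 1), Inl {t2, ?n + 2}, Inl {t3, ?n + 3},
       Inl {t4, ?n + 4}, Inl {?n + 2, ?n + 3}, Inl {?n + 3, ?n + 4}}"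
    unfolding nm_def I_def set_append set_map image_comp list.set by (rule refl)
  then have "set nm = medges M"
    unfolding M_def edge_subtraction_def multigraph.select_convs avoid
    by (simp only: image_Un image_insert image_empty) blast
  moreover have "distinct nm"
  proof -
    have "distinct (map ends (inner X))"
      using distinct_ends[OF X(1)] by (simp add: closed_edges_def open_edges_def)
    then have "distinct (map (Inl \<circ> ends) (inner X))" by (simp add: distinct_map inj_on_def)
    moreover have "ends e \<notin> {{t2, ?n + 2}, {t3, ?n + 3}, {t4, ?n + 4}, {?n + 2, ?n + 3}, {?n + 3, ?n + 4}}"
      if "e \<in> set (inner X)" for e
      using notI[of "ends e" "?n + 2"] notI[of "ends e" "?n + 3"] notI[of "ends e" "?n + 4"] that
      by (auto simp: I_def)
    ultimately show ?thesis
      using tl td unfolding nm_def by (auto simp: doubleton_eq_iff)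
  qed
  moreover have "mends M (Inr (Suc ?n)) = {t1, Suc (Suc ?n)}" using mends(3) by simp
  then have "list_all2 (\<lambda>x e. mends M x = ends e) nm es"
    unfolding nm_def es_def subtracted_tail_def t
    by (simp add: list_all2_append list_all2_map_self mends ends_def)
  ultimately have "card (three_edge_decompositions M) =
      card {cs. proper es cs \<and> cs ! (?l + 5) = 0 \<and> cs ! (?l + 3) = 1 \<and> cs ! (?l + 6) = 2}"
    \<comment> \<open>The three reference edges are those at the vertex n + 3.\<close>
    by (intro card_three_edge_decompositions)
      (simp_all add: es_def subtracted_tail_def t nth_append)
  also have "\<dots> = 3 * n" unfolding es_def using card_subtracted_colourings[OF X] .
  finally show ?thesis unfolding psi_def M_def by auto
qed

section \<open>Searching for small cuts\<close>

text \<open>Vertices are placed in the order \<open>rev vs\<close>. Every edge is recorded at the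
  end placed later, so that when \<open>v\<close> is placed, the list \<open>us\<close> contains
  only neighbours whose side is already known.\<close>

fun schedule :: "(nat \<times> nat) list \<Rightarrow> nat list \<Rightarrow> (nat \<times> nat list) list" where
  "schedule es [] = []"
| "schedule es (v # vs) = schedule (filter (\<lambda>(a, b). a \<noteq> v \<and> b \<noteq> v) es) vs @
     [(v, map (\<lambda>(a, b). if a = v then b else a) (filter (\<lambda>(a, b). a = v \<or> b = v) es))]"

text \<open>Branch and bound over all bipartitions: \<open>I\<close> and \<open>J\<close> are the
  two sides so far and \<open>c\<close> the cut edges counted so far. A branch is closed at 5 cut
  edges because no bound exceeds 5.\<close>

fun cut_search :: "(nat \<times> nat list) list \<Rightarrow> nat list \<Rightarrow> nat list \<Rightarrow> nat \<Rightarrow> bool" where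
  "cut_search [] I J c \<longleftrightarrow> min (cut_bound (length I)) (cut_bound (length J)) \<le> c"
| "cut_search ((v, us) # sc) I J c \<longleftrightarrow>
     (let a = c + length (filter (List.member I) us); b = c + length (filter (List.member J) us) in
      (if 5 \<le> a then True else cut_search sc I (v # J) a) \<and>
      (if 5 \<le> b then True else cut_search sc (v # I) J b))"

definition schedule_cut :: "(nat \<times> nat list) list \<Rightarrow> nat set \<Rightarrow> nat" where
  "schedule_cut sc S = (\<Sum>(v, us)\<leftarrow>sc. length (filter (\<lambda>u. (u \<in> S) \<noteq> (v \<in> S)) us))"

text \<open>Edges that avoid \<open>vs\<close> are dropped, hence only an inequality, which is the
  direction needed for lower bounds on cuts.\<close>

lemma schedule_cut_le: "schedule_cut (schedule es vs) S \<le> cut_size es S"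
proof (induction vs arbitrary: es)
  case (Cons v vs)
  let ?inc = "filter (\<lambda>(a, b). a = v \<or> b = v) es" and ?rest = "filter (\<lambda>(a, b). a \<noteq> v \<and> b \<noteq> v) es"
  have "cut_size es S = cut_size ?rest S + cut_size ?inc S"
    by (induction es) auto
  moreover have "cut_size ?inc S = length (filter (\<lambda>u. (u \<in> S) \<noteq> (v \<in> S))
      (map (\<lambda>(a, b). if a = v then b else a) ?inc))"
    by (induction es) auto
  ultimately show ?case using Cons.IH[of ?rest] by (simp add: schedule_cut_def)
qed (simp add: schedule_cut_def)

lemma map_fst_schedule: "map fst (schedule es vs) = rev vs"
  by (induction vs arbitrary: es) auto

lemma length_filter_mono:
  assumes "\<And>x. x \<in> set xs \<Longrightarrow> P x \<Longrightarrow> Q x"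
  shows "length (filter P xs) \<le> length (filter Q xs)"
  using assms by (induction xs) auto

text \<open>The branch prescribed by \<open>S\<close> itself is followed; it is abandoned only when
  5 edges cut by \<open>S\<close> have been counted.\<close>

lemma cut_search_sound:
  assumes "cut_search sc I J c" "set I \<subseteq> S" "set J \<inter> S = {}"
  shows "min (cut_bound (length I + length (filter (\<lambda>v. v \<in> S) (map fst sc))))
      (cut_bound (length J + length (filter (\<lambda>v. v \<notin> S) (map fst sc)))) \<le> c + schedule_cut sc S"
  using assms
proof (induction sc arbitrary: I J c)
  case (Cons w sc)
  obtain v us where w: "w = (v, us)" by (cases w)
  have cb: "cut_bound s \<le> 5" for s by (simp add: cut_bound_def)
  define d where "d = length (filter (\<lambda>u. (u \<in> S) \<noteq> (v \<in> S)) us)"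
  have cut: "schedule_cut (w # sc) S = d + schedule_cut sc S"
    by (simp add: schedule_cut_def w d_def)
  show ?case
  proof (cases "v \<in> S")
    case True
    define b where "b = c + length (filter (List.member J) us)"
    have "b \<le> c + d"
      unfolding b_def d_def using True Cons.prems(3) by (auto intro!: length_filter_mono)
    moreover have "5 \<le> b \<or> cut_search sc (v # I) J b"
      using Cons.prems(1) by (auto simp: w b_def Let_def split: if_splits)
    ultimately show ?thesis
      using Cons.IH[of "v # I" J b] Cons.prems(2,3) True cb[of "length I + length (filter (\<lambda>v. v \<in> S) (map fst (w # sc)))"]
      by (auto simp: cut[unfolded w] w)
  next
    case False
    define a where "a = c + length (filter (List.member I) us)"
    have "a \<le> c + d"
      unfolding a_def d_def using False Cons.prems(2) by (auto intro!: length_filter_mono)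
    moreover have "5 \<le> a \<or> cut_search sc I (v # J) a"
      using Cons.prems(1) by (auto simp: w a_def Let_def split: if_splits)
    ultimately show ?thesis
      using Cons.IH[of I "v # J" a] Cons.prems(2,3) False cb[of "length I + length (filter (\<lambda>v. v \<in> S) (map fst (w # sc)))"]
      by (auto simp: cut[unfolded w] w)
  qed
qed (simp add: schedule_cut_def)

lemma well_cut_search:
  assumes "cut_search (schedule es vs) [] [] 0" "sort vs = [0..<n]"
  shows "well_cut n es"
  unfolding well_cut_def
proof (intro allI impI)
  fix S assume S: "S \<subseteq> {..<n}"
  have vs: "distinct vs" "set vs = {..<n}"
    using distinct_sort[of "\<lambda>x. x" vs] set_sort[of "\<lambda>x. x" vs] unfolding assms(2) by auto
  have "length (filter (\<lambda>v. v \<in> T) (rev vs)) = card ({..<n} \<inter> T)" for T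
    using vs distinct_card[of "filter (\<lambda>v. v \<in> T) (rev vs)"] by (simp add: Int_def)
  from this[of S] this[of "- S"] have
    "length (filter (\<lambda>v. v \<in> S) (rev vs)) = card S"
    "length (filter (\<lambda>v. v \<notin> S) (rev vs)) = card ({..<n} - S)"
    using S by (simp_all add: Int_absorb1 Diff_eq)
  then show "min (cut_bound (card S)) (cut_bound (card ({..<n} - S))) \<le> cut_size es S"
    using cut_search_sound[OF assms(1), of S] schedule_cut_le[of es vs S]
    by (simp add: map_fst_schedule)
qed

section \<open>The gadgets\<close>

text \<open>The Petersen graph without its outer pentagon; the dangling edges are the
  spokes.\<close>

definition petersen_pole :: pole where
  "petersen_pole = Pole 5 pentagram [0, 1, 2, 3, 4]"

text \<open>Vertices 0 to 4 have only two edges here and await the dangling edges of the preceding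
  pole. In \<open>test_edges\<close> the closing pentagon occupies 16 to 20 and the pentagram 21 to
  25.\<close>

definition gadget5 :: pole where
  "gadget5 = Pole 16
     [(0, 1), (1, 7), (3, 4), (3, 13), (4, 15), (2, 5), (2, 10), (5, 6), (5, 8), (6, 7),
      (7, 9), (8, 9), (9, 10), (8, 12), (10, 11), (11, 12), (12, 13), (11, 14), (14, 15)]
     [13, 15, 6, 0, 14]"

definition gadget7 :: pole where
  "gadget7 = Pole 18
     [(0, 4), (4, 13), (1, 2), (1, 17), (2, 14), (13, 14), (12, 13), (14, 15), (3, 5), (3, 6),
      (5, 8), (8, 12), (7, 8), (11, 12), (6, 7), (6, 11), (7, 9), (10, 11), (9, 10), (9, 15),
      (10, 16), (16, 17)]
     [15, 17, 5, 0, 16]"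

lemma list_all_upt: "list_all P [0..<n] \<longleftrightarrow> (\<forall>v<n. P v)"
  by (auto simp: list_all_iff)

lemma petersen_pole:
  "wf_pole petersen_pole" "cubic_pole petersen_pole"
  "well_cut (order petersen_pole + 5) (closed_edges petersen_pole)" "starlike 1 petersen_pole"
proof -
  show wf: "wf_pole petersen_pole"
    by (auto simp: wf_pole_def petersen_pole_def pentagram_def)
  have "list_all (\<lambda>v. degree (open_edges petersen_pole) v = 3) [0..<5]" by code_simp
  then show "cubic_pole petersen_pole"
    by (simp add: cubic_pole_def list_all_upt petersen_pole_def)
  have "cut_search (schedule (closed_edges petersen_pole) (rev [0..<10])) [] [] 0"
    "sort (rev [0..<10]) = [0..<10 :: nat]" by code_simp+
  moreover have "order petersen_pole + 5 = 10" by (simp add: petersen_pole_def)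
  ultimately show "well_cut (order petersen_pole + 5) (closed_edges petersen_pole)"
    using well_cut_search by metis
  \<comment> \<open>Applied to the boundary patterns of the pole itself instead of a transfer list:
    each star pattern arises from exactly one colouring, and no other pattern arises.\<close>
  have "multiplies 1 (map (drop (length (inner petersen_pole))) (extensions [] (open_edges petersen_pole)))"
    by code_simp
  from multiplies_count[OF this] show "starlike 1 petersen_pole"
    by (simp add: starlike_def colour_count_extensions)
qed

lemma gadget5:
  "wf_pole gadget5" "\<forall>v<order gadget5. degree (stubs (order gadget5 + 5) @ open_edges gadget5) v = 3"
  "well_cut (order gadget5 + 10) (test_edges gadget5)"
proof -
  show "wf_pole gadget5" by (auto simp: wf_pole_def gadget5_def)
  have "list_all (\<lambda>v. degree (stubs 21 @ open_edges gadget5) v = 3) [0..<16]" by code_simp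
  then show "\<forall>v<order gadget5. degree (stubs (order gadget5 + 5) @ open_edges gadget5) v = 3"
    by (simp only: list_all_upt) (simp add: gadget5_def)
  \<comment> \<open>The order in which the search places the vertices. Each one after the first is
    adjacent to an earlier one, so cut edges accumulate early and branches close soon. Any
    permutation of the vertices is admissible.\<close>
  define vs :: "nat list" where "vs = [4, 3, 15, 25, 13, 24, 22, 14, 17, 16, 20, 23, 21, 12, 11, 1,
    0, 19, 18, 2, 10, 8, 5, 6, 7, 9]"
  have "cut_search (schedule (test_edges gadget5) (rev vs)) [] [] 0"
    unfolding vs_def by code_simp
  moreover have "sort (rev vs) = [0..<26]" unfolding vs_def by code_simp
  moreover have "order gadget5 + 10 = 26" by (simp add: gadget5_def)
  ultimately show "well_cut (order gadget5 + 10) (test_edges gadget5)"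
    using well_cut_search by metis
qed

lemma gadget7:
  "wf_pole gadget7" "\<forall>v<order gadget7. degree (stubs (order gadget7 + 5) @ open_edges gadget7) v = 3"
  "well_cut (order gadget7 + 10) (test_edges gadget7)"
proof -
  show "wf_pole gadget7" by (auto simp: wf_pole_def gadget7_def)
  have "list_all (\<lambda>v. degree (stubs 23 @ open_edges gadget7) v = 3) [0..<18]" by code_simp
  then show "\<forall>v<order gadget7. degree (stubs (order gadget7 + 5) @ open_edges gadget7) v = 3"
    by (simp only: list_all_upt) (simp add: gadget7_def)
  define vs :: "nat list" where "vs = [10, 9, 11, 16, 7, 6, 15, 12, 8, 17, 22, 18, 19, 3, 5, 20, 21,
    14, 13, 1, 2, 26, 24, 0, 4, 23, 25, 27]"
  have "cut_search (schedule (test_edges gadget7) (rev vs)) [] [] 0"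
    unfolding vs_def by code_simp
  moreover have "sort (rev vs) = [0..<28]" unfolding vs_def by code_simp
  moreover have "order gadget7 + 10 = 28" by (simp add: gadget7_def)
  ultimately show "well_cut (order gadget7 + 10) (test_edges gadget7)"
    using well_cut_search by metis
qed

lemma gadget5_multiplies: "multiplies 5 (transfer gadget5)"
  by code_simp

lemma gadget7_multiplies: "multiplies 7 (transfer gadget7)"
  by code_simp

lemma starlike_pole_exists:
  "\<exists>X. wf_pole X \<and> cubic_pole X \<and> well_cut (order X + 5) (closed_edges X) \<and> starlike (5 ^ i * 7 ^ j) X"
  (is "\<exists>X. ?good X (5 ^ i * 7 ^ j)")
proof -
  have five: "?good (glue X gadget5) (n * 5)" and seven: "?good (glue X gadget7) (n * 7)"
    if "?good X n" for X n
    using that gadget5 gadget5_multiplies gadget7 gadget7_multiplies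
    by (simp_all add: wf_glue cubic_glue well_cut_glue starlike_glue)
  have "\<exists>X. ?good X (5 ^ i)"
  proof (induction i)
    case 0
    show ?case using petersen_pole by auto
  next
    case (Suc i)
    then show ?case using five by (metis power_Suc2)
  qed
  then show ?thesis
  proof (induction j)
    case (Suc j)
    then obtain X where "?good X (5 ^ i * 7 ^ j)" by blast
    from seven[OF this] show ?case by (intro exI[of _ "glue X gadget7"]) (simp add: ac_simps)
  qed simp
qed

theorem theorem5p5:
  fixes i j n :: nat
  assumes "n = 5 ^ i * 7 ^ j"
  shows "\<exists>(G :: nat ugraph) e.
           snark G \<and> cyclically_edge_connected 5 G \<and> e \<in> uedges G \<and> psi G e = n"
proof -
  obtain X where X: "wf_pole X" "cubic_pole X" "well_cut (order X + 5) (closed_edges X)"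
    "starlike n X"
    using starlike_pole_exists[of i j] assms by blast
  interpret well_cut_cubic_graph "{..<order X + 5}" "ends ` set (closed_edges X)"
    using well_cut_cubic_pole_graph[OF X(1-3)] .
  have "snark (pole_graph X)" "cyclically_edge_connected 5 (pole_graph X)"
    using starlike_not_colourable[OF X(1,4)] snarkI cyclically_5_edge_connected
    by (auto simp: pole_graph_def)
  moreover have "{order X, order X + 1} \<in> uedges (pole_graph X)"
    by (auto simp: pole_graph_def closed_edges_def pentagon_def ends_def)
  ultimately show ?thesis using psi_pole_graph[OF X(1,4)] by blast
qed

end
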